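(* Let $n\ge1$ and let $f:M\to\mathbb{R}^{n+1}$ be a hyperbolic affine sphere with positive definite Blaschke metric $h$. Then its Blaschke lift $\mathcal{G}_f:(M,h)\to\mathbb{X}_{n+1}$ is a harmonic map.
   Context: Hyperbolic affine sphere. $M$ is a smooth oriented $n$-manifold, $D$ the flat connection of $\mathbb{R}^{n+1}$, $\det$ the standard volume form. A hyperbolic affine sphere (normalized: centre at the origin, affine normal $\xi=f$, shape operator $S=-\mathrm{Id}$) is an immersion $f:M\to\mathbb{R}^{n+1}$ such that $\mathbb{R}^{n+1}=f_*(T_pM)\oplus\mathbb{R}f(p)$ for all $p$, $D_Xf_*Y=f_*(\nabla_XY)+h(X,Y)f$ with $h$ positive definite, and $\det(f_*X_1,\dots,f_*X_n,f)=\omega_h(X_1,\dots,X_n)$ (up to orientation), where $\omega_h$ is the volume form of $h$ (Blaschke condition). $h$ is called the Blaschke (affine) metric. Symmetric space. $\mathbb{X}_{n+1}=\mathrm{SL}(n+1,\mathbb{R})/\mathrm{SO}(n+1)$ is identified with the space of scalar products on $\mathbb{R}^{n+1}$ of determinant $1$ (in the standard basis), endowed with the $\mathrm{SL}(n+1,\mathbb{R})$-invariant Riemannian metric induced by the Killing form. Blaschke lift. $\mathcal{G}_f(p)$ is the scalar product $Q_p$ on $\mathbb{R}^{n+1}=f_*(T_pM)\oplus\mathbb{R}f(p)$ such that $Q_p(f_*X,f_*Y)=h_p(X,Y)$, $f(p)$ is $Q_p$-orthogonal to $f_*(T_pM)$, and $Q_p(f(p),f(p))=\lambda(p)>0$ is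 determined by $\det Q_p=1$, i.e. $\lambda(p)=(\det h_p)^{-1}$, with $\det h_p$ computed in a basis $X_1,\dots,X_n$ of $T_pM$ with $|\det(f_*X_1,\dots,f_*X_n,f(p))|=1$. Harmonic means that the tension field $\operatorname{tr}_h\nabla^\otimes d\mathcal{G}_f$ vanishes. *)

theory Defs
  imports "HOL-Analysis.Analysis"
begin

section \<open>Smooth maps on open sets\<close>

primrec times_differentiable_on ::
    "nat \<Rightarrow> 'a set \<Rightarrow> ('a::real_normed_vector \<Rightarrow> 'b::real_normed_vector) \<Rightarrow> bool" where
  "times_differentiable_on 0 U f \<longleftrightarrow> continuous_on U f"
| "times_differentiable_on (Suc k) U f \<longleftrightarrow>
     (\<forall>x\<in>U. f differentiable (at x)) \<and>
     (\<forall>v. times_differentiable_on k U (\<lambda>x. frechet_derivative f (at x) v))"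

text \<open>Intended for open \<open>U\<close> in a finite-dimensional space, where this is \<open>C\<^sup>\<infinity>\<close> on \<open>U\<close>.\<close>

definition smooth_on :: "'a set \<Rightarrow> ('a::real_normed_vector \<Rightarrow> 'b::real_normed_vector) \<Rightarrow> bool" where
  "smooth_on U f \<longleftrightarrow> (\<forall>k. times_differentiable_on k U f)"


section \<open>Oriented smooth manifolds\<close>

text \<open>The manifold is the whole type \<open>'m\<close>, and \<open>n = CARD('n)\<close>. A chart is its domain together with
  its coordinate map. Only the values of the coordinate map on the domain matter.\<close>

type_synonym ('m, 'n) chart = "'m set \<times> ('m \<Rightarrow> real^'n)"

definition chart_image :: "('m, 'n::finite) chart \<Rightarrow> (real^'n) set" where
  "chart_image c = snd c ` fst c"

definition chart_inv :: "('m, 'n::finite) chart \<Rightarrow> real^'n \<Rightarrow> 'm" where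
  "chart_inv c = inv_into (fst c) (snd c)"

definition is_chart :: "('m::topological_space, 'n::finite) chart \<Rightarrow> bool" where
  "is_chart c \<longleftrightarrow> open (fst c) \<and> open (chart_image c) \<and>
     homeomorphism (fst c) (chart_image c) (snd c) (chart_inv c)"

definition transition :: "('m, 'n::finite) chart \<Rightarrow> ('m, 'n) chart \<Rightarrow> real^'n \<Rightarrow> real^'n" where
  "transition c d = snd d \<circ> chart_inv c"

definition oriented_smooth_atlas :: "('m::topological_space, 'n::finite) chart set \<Rightarrow> bool" where
  "oriented_smooth_atlas A \<longleftrightarrow>
     (\<forall>c\<in>A. is_chart c) \<and> (\<Union>c\<in>A. fst c) = UNIV \<and>
     (\<forall>c\<in>A. \<forall>d\<in>A. smooth_on (snd c ` (fst c \<inter> fst d)) (transition c d) \<and>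
        (\<forall>x \<in> snd c ` (fst c \<inter> fst d).
           det (matrix (frechet_derivative (transition c d) (at x))) > 0))"

definition local_rep :: "('m, 'n::finite) chart \<Rightarrow> ('m \<Rightarrow> 'b) \<Rightarrow> real^'n \<Rightarrow> 'b" where
  "local_rep c \<phi> = \<phi> \<circ> chart_inv c"

text \<open>A covariant 2-tensor field is given by its expressions in the charts: \<open>h c x u v\<close> is the value
  at the point with coordinates \<open>x\<close> on the tangent vectors with components \<open>u\<close> and \<open>v\<close> in the
  chart \<open>c\<close>.\<close>

type_synonym ('m, 'n) tensor2 = "('m, 'n) chart \<Rightarrow> real^'n \<Rightarrow> real^'n \<Rightarrow> real^'n \<Rightarrow> real"

definition riemannian_metric ::
    "('m::topological_space, 'n::finite) chart set \<Rightarrow> ('m, 'n) tensor2 \<Rightarrow> bool" where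
  "riemannian_metric A h \<longleftrightarrow>
     (\<forall>c\<in>A. (\<forall>u v. smooth_on (chart_image c) (\<lambda>x. h c x u v)) \<and>
        (\<forall>x\<in>chart_image c. bilinear (h c x) \<and>
           (\<forall>u v. h c x u v = h c x v u) \<and> (\<forall>u. u \<noteq> 0 \<longrightarrow> h c x u u > 0))) \<and>
     (\<forall>c\<in>A. \<forall>d\<in>A. \<forall>x \<in> snd c ` (fst c \<inter> fst d). \<forall>u v.
        h c x u v = h d (transition c d x)
          (frechet_derivative (transition c d) (at x) u)
          (frechet_derivative (transition c d) (at x) v))"

definition gram :: "(real^'n \<Rightarrow> real^'n \<Rightarrow> real) \<Rightarrow> real^'n^'n::finite" where
  "gram b = (\<chi> i j. b (axis i 1) (axis j 1))"

text \<open>In a positively oriented chart the volume form of the metric is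
  \<open>sqrt (det h\<^sub>i\<^sub>j) dx\<^sub>1 \<and> \<dots> \<and> dx\<^sub>n\<close>.\<close>

definition volume_form :: "(real^'n \<Rightarrow> real^'n \<Rightarrow> real) \<Rightarrow> ('n \<Rightarrow> real^'n) \<Rightarrow> real" where
  "volume_form b X = sqrt (det (gram b)) * det (\<chi> a i. X i $ a :: real^'n^'n::finite)"

text \<open>The covariant derivative of the vector field \<open>Y\<close> along \<open>X\<close> in coordinates, for the
  connection with Christoffel symbols \<open>\<Gamma>\<close>.\<close>

definition cov_deriv ::
    "('a \<Rightarrow> 'a \<Rightarrow> 'a \<Rightarrow> 'a) \<Rightarrow> ('a \<Rightarrow> 'a) \<Rightarrow> ('a \<Rightarrow> 'a) \<Rightarrow> 'a \<Rightarrow> 'a::real_normed_vector" where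
  "cov_deriv \<Gamma> X Y x = frechet_derivative Y (at x) (X x) + \<Gamma> x (X x) (Y x)"


section \<open>Hyperbolic affine spheres\<close>

text \<open>\<open>real^('n option)\<close> is the ambient space of dimension \<open>n + 1\<close>. The column with index
  \<open>Some i\<close> is the image of the \<open>i\<close>-th tangent vector, the column with index \<open>None\<close> is the position
  vector.\<close>

definition frame_matrix ::
    "('n::finite \<Rightarrow> real^('n option)) \<Rightarrow> real^('n option) \<Rightarrow> real^('n option)^('n option)" where
  "frame_matrix W \<xi> = (\<chi> a b. (case b of Some i \<Rightarrow> W i | None \<Rightarrow> \<xi>) $ a)"

text \<open>The condition below is the normalized case: centre at the origin, affine normal \<open>F\<close>.
  The shape operator is then \<open>- id\<close>, because the derivative of the normal \<open>F\<close> along \<open>X\<close> is the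
  push-forward of \<open>X\<close>. Symmetry and positivity of \<open>h\<close> are part of \<open>riemannian_metric\<close>.\<close>

definition hyperbolic_affine_sphere ::
    "('m::topological_space, 'n::finite) chart set \<Rightarrow> ('m, 'n) tensor2 \<Rightarrow>
     ('m \<Rightarrow> real^('n option)) \<Rightarrow> bool" where
  "hyperbolic_affine_sphere A h f \<longleftrightarrow> riemannian_metric A h \<and>
     (\<forall>c\<in>A. let U = chart_image c; F = local_rep c f; dF = (\<lambda>x. frechet_derivative F (at x)) in
        smooth_on U F \<and>
        (\<forall>x\<in>U. inj (dF x)) \<and>
        (\<forall>x\<in>U. F x \<noteq> 0 \<and> range (dF x) \<inter> span {F x} = {0} \<and>
           {a + b | a b. a \<in> range (dF x) \<and> b \<in> span {F x}} = UNIV) \<and>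
        (\<exists>\<Gamma>. (\<forall>x\<in>U. bilinear (\<Gamma> x)) \<and>
           (\<forall>X Y. smooth_on U X \<longrightarrow> smooth_on U Y \<longrightarrow>
              (\<forall>x\<in>U. frechet_derivative (\<lambda>y. dF y (Y y)) (at x) (X x) =
                 dF x (cov_deriv \<Gamma> X Y x) + h c x (X x) (Y x) *\<^sub>R F x))) \<and>
        (\<forall>x\<in>U. \<exists>s\<in>{1, -1}. \<forall>X.
           det (frame_matrix (\<lambda>i. dF x (X i)) (F x)) = s * volume_form (h c x) X))"


section \<open>The symmetric space \<open>SL/SO\<close>\<close>

text \<open>A scalar product is represented by its Gram matrix in the standard basis.\<close>

definition scalar_prod :: "real^'k^'k \<Rightarrow> real^'k \<Rightarrow> real^'k \<Rightarrow> real" where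
  "scalar_prod Q v w = v \<bullet> (Q *v w)"

definition sym_space :: "(real^'k^'k::finite) set" where
  "sym_space = {Q. transpose Q = Q \<and> (\<forall>v. v \<noteq> 0 \<longrightarrow> scalar_prod Q v v > 0) \<and> det Q = 1}"

definition sl_algebra :: "(real^'k^'k::finite) set" where
  "sl_algebra = {X. trace X = 0}"

definition endo_trace :: "'a::euclidean_space set \<Rightarrow> ('a \<Rightarrow> 'a) \<Rightarrow> real" where
  "endo_trace V T =
     (let B = (SOME B. B \<subseteq> V \<and> pairwise orthogonal B \<and> (\<forall>b\<in>B. norm b = 1) \<and> span B = V)
      in \<Sum>b\<in>B. b \<bullet> T b)"

definition lie_bracket :: "real^'k^'k \<Rightarrow> real^'k^'k \<Rightarrow> real^'k^'k::finite" where
  "lie_bracket X Y = X ** Y - Y ** X"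

definition killing_form :: "real^'k^'k \<Rightarrow> real^'k^'k::finite \<Rightarrow> real" where
  "killing_form X Y = endo_trace sl_algebra (lie_bracket X \<circ> lie_bracket Y)"

text \<open>The image of the standard scalar product under \<open>g\<close>, where \<open>SL\<close> acts on scalar products by
  \<open>(g \<cdot> Q)(v, w) = Q(g\<^sup>-\<^sup>1 v, g\<^sup>-\<^sup>1 w)\<close>. The stabilizer of the base point \<open>mat 1\<close> is \<open>SO\<close>.\<close>

definition orbit_map :: "real^'k^'k \<Rightarrow> real^'k^'k::finite" where
  "orbit_map g = transpose (matrix_inv g) ** matrix_inv g"

text \<open>For symmetric trace-free \<open>X\<close>, the curve \<open>orbit_map (g exp(tX))\<close> has the velocity
  \<open>H = - 2 g\<^sup>-\<^sup>T X g\<^sup>-\<^sup>1\<close> at \<open>t = 0\<close>, so \<open>H\<close> corresponds to \<open>X = - 1/2 g\<^sup>T H g\<close> in the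
  Cartan complement of \<open>so\<close>, on which the Killing form is positive definite. Another choice of \<open>g\<close>
  conjugates \<open>X\<close> by an element of \<open>SO\<close>, which leaves the Killing form unchanged.\<close>

definition killing_metric :: "real^'k^'k \<Rightarrow> real^'k^'k \<Rightarrow> real^'k^'k::finite \<Rightarrow> real" where
  "killing_metric Q H K =
     (let g = (SOME g. det g = 1 \<and> orbit_map g = Q)
      in killing_form ((- 1/2) *\<^sub>R (transpose g ** H ** g)) ((- 1/2) *\<^sub>R (transpose g ** K ** g)))"


section \<open>Levi-Civita connections and harmonic maps\<close>

text \<open>Here \<open>S\<close> is an embedded submanifold of a Euclidean space. It carries an arbitrary Riemannian
  metric \<open>g\<close>, which need not be induced by the inner product. Chart images are open and are the
  special case of codimension zero.\<close>

definition smooth_curve_in :: "'a::real_normed_vector set \<Rightarrow> (real \<Rightarrow> 'a) \<Rightarrow> bool" where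
  "smooth_curve_in S \<gamma> \<longleftrightarrow> smooth_on UNIV \<gamma> \<and> range \<gamma> \<subseteq> S"

definition tangent_space_of :: "'a::real_normed_vector set \<Rightarrow> 'a \<Rightarrow> 'a set" where
  "tangent_space_of S q =
     {v. \<exists>\<gamma>. smooth_curve_in S \<gamma> \<and> \<gamma> 0 = q \<and> vector_derivative \<gamma> (at 0) = v}"

definition tangent_field_along ::
    "'a::real_normed_vector set \<Rightarrow> (real \<Rightarrow> 'a) \<Rightarrow> (real \<Rightarrow> 'a) \<Rightarrow> bool" where
  "tangent_field_along S \<gamma> V \<longleftrightarrow> smooth_on UNIV V \<and> (\<forall>t. V t \<in> tangent_space_of S (\<gamma> t))"

definition cov_deriv_along ::
    "('a \<Rightarrow> 'a \<Rightarrow> 'a \<Rightarrow> 'a) \<Rightarrow> (real \<Rightarrow> 'a) \<Rightarrow> (real \<Rightarrow> 'a) \<Rightarrow> real \<Rightarrow> 'a::real_normed_vector" where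
  "cov_deriv_along \<Gamma> \<gamma> V t =
     vector_derivative V (at t) + \<Gamma> (\<gamma> t) (vector_derivative \<gamma> (at t)) (V t)"

text \<open>Every connection on \<open>S\<close> has the form \<open>D + \<Gamma>\<close> for the flat derivative \<open>D\<close> of the ambient
  space, and it is torsion-free if and only if \<open>\<Gamma>\<close> is symmetric on tangent vectors. The values of
  \<open>\<Gamma>\<close> on other vectors are irrelevant.\<close>

definition levi_civita ::
    "'a::real_normed_vector set \<Rightarrow> ('a \<Rightarrow> 'a \<Rightarrow> 'a \<Rightarrow> real) \<Rightarrow> ('a \<Rightarrow> 'a \<Rightarrow> 'a \<Rightarrow> 'a) \<Rightarrow> bool" where
  "levi_civita S g \<Gamma> \<longleftrightarrow>
     (\<forall>q\<in>S. bilinear (\<Gamma> q) \<and>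
        (\<forall>u\<in>tangent_space_of S q. \<forall>v\<in>tangent_space_of S q. \<Gamma> q u v = \<Gamma> q v u)) \<and>
     (\<forall>\<gamma> V. smooth_curve_in S \<gamma> \<longrightarrow> tangent_field_along S \<gamma> V \<longrightarrow>
        (\<forall>t. cov_deriv_along \<Gamma> \<gamma> V t \<in> tangent_space_of S (\<gamma> t))) \<and>
     (\<forall>\<gamma> V W. smooth_curve_in S \<gamma> \<longrightarrow> tangent_field_along S \<gamma> V \<longrightarrow> tangent_field_along S \<gamma> W \<longrightarrow>
        (\<forall>t. ((\<lambda>s. g (\<gamma> s) (V s) (W s)) has_real_derivative
           g (\<gamma> t) (cov_deriv_along \<Gamma> \<gamma> V t) (W t) + g (\<gamma> t) (V t) (cov_deriv_along \<Gamma> \<gamma> W t)) (at t)))"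

definition christoffel ::
    "'a::real_normed_vector set \<Rightarrow> ('a \<Rightarrow> 'a \<Rightarrow> 'a \<Rightarrow> real) \<Rightarrow> 'a \<Rightarrow> 'a \<Rightarrow> 'a \<Rightarrow> 'a" where
  "christoffel S g = (SOME \<Gamma>. levi_civita S g \<Gamma>)"

text \<open>\<open>(\<nabla> d\<Phi>)(X, Y)\<close> is the covariant derivative of \<open>d\<Phi>(Y)\<close> along \<open>X\<close> in the pulled back
  tangent bundle, minus \<open>d\<Phi>(\<nabla>\<^sub>X Y)\<close>.\<close>

definition second_fundamental_form ::
    "('a \<Rightarrow> 'a \<Rightarrow> 'a \<Rightarrow> 'a) \<Rightarrow> ('b \<Rightarrow> 'b \<Rightarrow> 'b \<Rightarrow> 'b) \<Rightarrow>
     ('a::real_normed_vector \<Rightarrow> 'b::real_normed_vector) \<Rightarrow> ('a \<Rightarrow> 'a) \<Rightarrow> ('a \<Rightarrow> 'a) \<Rightarrow> 'a \<Rightarrow> 'b" where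
  "second_fundamental_form \<Gamma> \<Gamma>' \<Phi> X Y x =
     (let d\<Phi> = (\<lambda>y. frechet_derivative \<Phi> (at y)) in
        frechet_derivative (\<lambda>y. d\<Phi> y (Y y)) (at x) (X x)
        + \<Gamma>' (\<Phi> x) (d\<Phi> x (X x)) (d\<Phi> x (Y x))
        - d\<Phi> x (cov_deriv \<Gamma> X Y x))"

definition tension_field ::
    "(real^'n::finite) set \<Rightarrow> (real^'n \<Rightarrow> real^'n \<Rightarrow> real^'n \<Rightarrow> real) \<Rightarrow>
     'b set \<Rightarrow> ('b \<Rightarrow> 'b \<Rightarrow> 'b \<Rightarrow> real) \<Rightarrow> (real^'n \<Rightarrow> 'b::real_normed_vector) \<Rightarrow> real^'n \<Rightarrow> 'b" where
  "tension_field U h S g \<Phi> x =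
     (\<Sum>i\<in>UNIV. \<Sum>j\<in>UNIV. matrix_inv (gram (h x)) $ i $ j *\<^sub>R
        second_fundamental_form (christoffel U h) (christoffel S g) \<Phi>
          (\<lambda>_. axis i 1) (\<lambda>_. axis j 1) x)"

definition harmonic_map ::
    "('m::topological_space, 'n::finite) chart set \<Rightarrow> ('m, 'n) tensor2 \<Rightarrow>
     'b::real_normed_vector set \<Rightarrow> ('b \<Rightarrow> 'b \<Rightarrow> 'b \<Rightarrow> real) \<Rightarrow> ('m \<Rightarrow> 'b) \<Rightarrow> bool" where
  "harmonic_map A h S g \<phi> \<longleftrightarrow> range \<phi> \<subseteq> S \<and>
     (\<forall>c\<in>A. smooth_on (chart_image c) (local_rep c \<phi>) \<and>
        (\<forall>x\<in>chart_image c. tension_field (chart_image c) (h c) S g (local_rep c \<phi>) x = 0))"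


section \<open>The Blaschke lift\<close>

text \<open>The value of \<open>Q\<close> on \<open>(f p, f p)\<close> is determined by \<open>det Q = 1\<close>, which is part of
  \<open>sym_space\<close>.\<close>

definition blaschke_lift ::
    "('m::topological_space, 'n::finite) chart set \<Rightarrow> ('m, 'n) tensor2 \<Rightarrow>
     ('m \<Rightarrow> real^('n option)) \<Rightarrow> 'm \<Rightarrow> real^('n option)^('n option)" where
  "blaschke_lift A h f p =
     (THE Q. Q \<in> sym_space \<and>
        (\<forall>c\<in>A. p \<in> fst c \<longrightarrow>
           (let x = snd c p; df = frechet_derivative (local_rep c f) (at x) in
              (\<forall>u v. scalar_prod Q (df u) (df v) = h c x u v) \<and>
              (\<forall>u. scalar_prod Q (df u) (f p) = 0))))"

end

(* Write E_u for the derivative of f in direction u, Q for the Blaschke lift in a chart, and q_u for the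
   derivative of Q. The Blaschke condition gives Q(f, f) = 1. The structure equation is only used in the
   form Q(D_u E_v, f) = h(u, v). Differentiating Q(f, f) = 1 and Q(E_v, f) = 0 yields q_u f = -2 Q E_u;
   differentiating this once more, symmetry of second derivatives gives q_u E_v = q_v E_u. Then the
   Koszul formula gives E(L(u, v)) = D_u E_v + Q^-1 q_u E_v / 2 for the Levi-Civita connection L of h.
   On the symmetric space the Levi-Civita connection is D - (H Q^-1 K + K Q^-1 H) / 2.
   Hence the second fundamental form T(u, v) of Q annihilates f, and T(u, v)(E_a, E_b) is totally
   symmetric. As det Q = 1, the trace of Q^-1 T(u, v) is zero, and by total symmetry this is the
   tension field evaluated on E_u, E_v. *)

theory Submission
  imports Defs
begin

section \<open>Calculus of smooth maps\<close>

text \<open>The obstacle is that most objects are given by choice: \<open>christoffel\<close> picks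
  some Levi-Civita connection, \<open>killing_metric\<close> some \<open>g\<close>,
  \<open>endo_trace\<close> some orthonormal basis, and the lift is a \<open>THE\<close> over all
  charts at a point. Each is first replaced by a closed formula. For the connections this takes
  existence and uniqueness, and on \<open>sym_space\<close>, which has positive codimension in the
  matrices, the symbols are determined on tangent vectors only; hence its tangent spaces are
  computed exactly. For the lift the closed formula is Q^-1 = sum g^ij E_i E_j^T + f f^T, where g^ij
  is the inverse matrix of h. It yields uniqueness and smoothness of the lift, and it is also the
  reason why a trace with Q^-1 is a contraction with g^ij for every T that annihilates f.\<close>

abbreviation dir_deriv ::
    "('a::real_normed_vector \<Rightarrow> 'b::real_normed_vector) \<Rightarrow> 'a \<Rightarrow> 'a \<Rightarrow> 'b" where
  "dir_deriv f v x \<equiv> frechet_derivative f (at x) v"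

lemma dir_deriv_eqI: "(f has_derivative f') (at x) \<Longrightarrow> dir_deriv f v x = f' v"
  by (simp add: frechet_derivative_at[symmetric])

lemma has_derivative_cong_open:
  assumes "open U" "x \<in> U" "\<And>y. y \<in> U \<Longrightarrow> f y = g y"
  shows "(f has_derivative D) (at x) \<longleftrightarrow> (g has_derivative D) (at x)"
  using assms by (metis has_derivative_transform_within_open)

lemma frechet_derivative_cong_open:
  assumes "open U" "x \<in> U" "\<And>y. y \<in> U \<Longrightarrow> f y = g y"
  shows "frechet_derivative f (at x) = frechet_derivative g (at x)"
  unfolding frechet_derivative_def by (simp add: has_derivative_cong_open[OF assms])

lemma differentiable_cong_open:
  assumes "open U" "x \<in> U" "\<And>y. y \<in> U \<Longrightarrow> f y = g y"
  shows "f differentiable (at x) \<longleftrightarrow> g differentiable (at x)"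
  unfolding differentiable_def by (simp add: has_derivative_cong_open[OF assms])

text \<open>Derivative rules give a formula for \<open>dir_deriv\<close> only at points of
  \<open>U\<close>. The closure lemmas below prove regularity of that formula and carry it back with
  this lemma; openness of \<open>U\<close> lets derivatives see only the values on
  \<open>U\<close>.\<close>

lemma times_differentiable_on_cong:
  assumes "open U" "\<And>y. y \<in> U \<Longrightarrow> f y = g y" "times_differentiable_on k U f"
  shows "times_differentiable_on k U g"
  using assms(2,3)
proof (induction k arbitrary: f g)
  case 0
  then show ?case using continuous_on_cong[of U U f g] by simp
next
  case (Suc k)
  have 1: "times_differentiable_on k U (\<lambda>x. dir_deriv g v x)" for v
  proof (rule Suc.IH)
    show "times_differentiable_on k U (\<lambda>x. dir_deriv f v x)"
      using Suc.prems(2) by simp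
    show "dir_deriv f v y = dir_deriv g v y" if "y \<in> U" for y
      using frechet_derivative_cong_open[OF assms(1) that, of f g] Suc.prems(1) by simp
  qed
  have 2: "g differentiable (at x)" if "x \<in> U" for x
    using differentiable_cong_open[OF assms(1) that, of f g] Suc.prems that by simp
  show ?case using 1 2 by simp
qed

lemma times_differentiable_on_continuous:
  "times_differentiable_on k U f \<Longrightarrow> continuous_on U f"
  by (cases k) (auto intro!: continuous_at_imp_continuous_on differentiable_imp_continuous_within)

lemma times_differentiable_on_SucD:
  "times_differentiable_on (Suc k) U f \<Longrightarrow> times_differentiable_on k U f"
proof (induction k arbitrary: f)
  case 0
  then show ?case using times_differentiable_on_continuous[OF 0] by simp
next
  case (Suc k)
  have "f differentiable (at x)" if "x \<in> U" for x
    using Suc.prems that by (metis times_differentiable_on.simps(2))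
  moreover have "times_differentiable_on k U (\<lambda>x. dir_deriv f v x)" for v
    using Suc.prems Suc.IH by (metis times_differentiable_on.simps(2))
  ultimately show ?case by simp
qed

lemma times_differentiable_on_const: "times_differentiable_on k U (\<lambda>x. c)"
  by (induction k arbitrary: c) auto

lemma times_differentiable_on_add:
  assumes "open U"
  shows "times_differentiable_on k U f \<Longrightarrow> times_differentiable_on k U g \<Longrightarrow>
    times_differentiable_on k U (\<lambda>x. f x + g x)"
proof (induction k arbitrary: f g)
  case 0
  then show ?case by (simp add: continuous_on_add)
next
  case (Suc k)
  have D: "((\<lambda>x. f x + g x) has_derivative
      (\<lambda>h. dir_deriv f h x + dir_deriv g h x)) (at x)" if "x \<in> U" for x
    using Suc.prems that by (intro has_derivative_add) (auto simp: frechet_derivative_works)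
  have "times_differentiable_on k U (\<lambda>x. dir_deriv (\<lambda>x. f x + g x) v x)" for v
    using Suc by (intro times_differentiable_on_cong[OF assms dir_deriv_eqI[OF D, symmetric]]) auto
  then show ?case using D by (auto simp: differentiable_def)
qed

text \<open>One product rule for real products, scaling, matrix products, matrix times vector and
  outer products. The derivative is a sum of such products with one factor differentiated; lowering
  the order of the other factor by \<open>times_differentiable_on_SucD\<close> closes the
  induction.\<close>

lemma times_differentiable_on_bilinear:
  assumes "bounded_bilinear B" "open U"
  shows "times_differentiable_on k U f \<Longrightarrow> times_differentiable_on k U g \<Longrightarrow>
    times_differentiable_on k U (\<lambda>x. B (f x) (g x))"
proof (induction k arbitrary: f g)
  case 0
  then show ?case
    using bounded_bilinear.continuous_on[OF assms(1)] by simp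
next
  case (Suc k)
  have D: "((\<lambda>x. B (f x) (g x)) has_derivative
      (\<lambda>h. B (f x) (dir_deriv g h x) + B (dir_deriv f h x) (g x))) (at x)" if "x \<in> U" for x
    using Suc.prems that
    by (intro bounded_bilinear.FDERIV[OF assms(1)]) (auto simp: frechet_derivative_works)
  have "times_differentiable_on k U (\<lambda>x. dir_deriv (\<lambda>x. B (f x) (g x)) v x)" for v
    using Suc.prems times_differentiable_on_SucD[OF Suc.prems(1)]
      times_differentiable_on_SucD[OF Suc.prems(2)]
    by (intro times_differentiable_on_cong[OF assms(2) dir_deriv_eqI[OF D, symmetric]])
      (auto intro!: times_differentiable_on_add[OF assms(2)] Suc.IH simp del: times_differentiable_on.simps
        simp: times_differentiable_on.simps(2)[of k])
  then show ?case using D by (auto simp: differentiable_def)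
qed

lemma times_differentiable_on_inverse:
  fixes f :: "'a::real_normed_vector \<Rightarrow> real"
  assumes "open U" "\<And>x. x \<in> U \<Longrightarrow> f x \<noteq> 0"
  shows "times_differentiable_on k U f \<Longrightarrow> times_differentiable_on k U (\<lambda>x. inverse (f x))"
proof (induction k)
  case 0
  then show ?case using assms(2) by (auto intro!: continuous_intros)
next
  case (Suc k)
  \<comment> \<open>The sign is written as a constant factor, so that the derivative is a pure
    product of \<open>inverse (f x)\<close>, covered by the induction hypothesis, and a derivative
    of \<open>f\<close>.\<close>
  have D: "((\<lambda>x. inverse (f x)) has_derivative
      (\<lambda>h. - 1 * ((inverse (f x) * dir_deriv f h x) * inverse (f x)))) (at x)" if "x \<in> U" for x
    using Deriv.has_derivative_inverse[of f x, OF assms(2)[OF that]] Suc.prems that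
    by (simp add: frechet_derivative_works)
  have f: "times_differentiable_on k U f" using Suc.prems by (rule times_differentiable_on_SucD)
  note mult = times_differentiable_on_bilinear[OF bounded_bilinear_mult assms(1)]
  have "times_differentiable_on k U (\<lambda>x. dir_deriv (\<lambda>x. inverse (f x)) v x)" for v
    using Suc.prems Suc.IH[OF f]
    by (intro times_differentiable_on_cong[OF assms(1) dir_deriv_eqI[OF D, symmetric]] mult
        times_differentiable_on_const) auto
  then show ?case using D by (auto simp: differentiable_def)
qed

text \<open>The exponent is general in the induction, since each derivative lowers it by one. A
  negative real power later scales matrices to determinant 1.\<close>

lemma times_differentiable_on_powr:
  fixes f :: "'a::real_normed_vector \<Rightarrow> real"
  assumes "open U" "\<And>x. x \<in> U \<Longrightarrow> f x > 0"
  shows "times_differentiable_on k U f \<Longrightarrow> times_differentiable_on k U (\<lambda>x. f x powr a)"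
proof (induction k arbitrary: a)
  case 0
  then show ?case using assms(2) by (fastforce intro!: continuous_intros)
next
  case (Suc k)
  have D: "((\<lambda>x. f x powr a) has_derivative
      (\<lambda>h. a * (f x powr (a - 1) * dir_deriv f h x))) (at x)" if "x \<in> U" for x
  proof -
    have "((\<lambda>y. y powr a) has_derivative (\<lambda>h. (a * f x powr (a - 1)) * h)) (at (f x))"
      using has_real_derivative_powr[OF assms(2)[OF that], of a]
      by (simp add: has_field_derivative_def)
    moreover have "(f has_derivative (\<lambda>h. dir_deriv f h x)) (at x)"
      using Suc.prems that by (simp add: frechet_derivative_works)
    ultimately show ?thesis using diff_chain_at[of f _ x "\<lambda>y. y powr a"]
      by (fastforce simp: o_def mult.assoc)
  qed
  have f: "times_differentiable_on k U f" using Suc.prems by (rule times_differentiable_on_SucD)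
  note mult = times_differentiable_on_bilinear[OF bounded_bilinear_mult assms(1)]
  have "times_differentiable_on k U (\<lambda>x. dir_deriv (\<lambda>x. f x powr a) v x)" for v
    using Suc.prems Suc.IH[OF f]
    by (intro times_differentiable_on_cong[OF assms(1) dir_deriv_eqI[OF D, symmetric]] mult
        times_differentiable_on_const) auto
  then show ?case using D by (auto simp: differentiable_def)
qed

lemma smooth_on_cong:
  "open U \<Longrightarrow> (\<And>y. y \<in> U \<Longrightarrow> f y = g y) \<Longrightarrow> smooth_on U f \<Longrightarrow> smooth_on U g"
  unfolding smooth_on_def using times_differentiable_on_cong by blast

lemma smooth_on_const [intro]: "smooth_on U (\<lambda>x. c)"
  by (simp add: smooth_on_def times_differentiable_on_const)

lemma smooth_on_ident: "smooth_on U (\<lambda>x. x)"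
  unfolding smooth_on_def
proof
  fix k show "times_differentiable_on k U (\<lambda>x. x)"
    by (cases k) (auto simp: times_differentiable_on_const)
qed

lemma smooth_on_bilinear:
  "bounded_bilinear B \<Longrightarrow> open U \<Longrightarrow> smooth_on U f \<Longrightarrow> smooth_on U g \<Longrightarrow>
    smooth_on U (\<lambda>x. B (f x) (g x))"
  by (simp add: smooth_on_def times_differentiable_on_bilinear)

lemma smooth_on_linear:
  assumes "bounded_linear L" "open U" "smooth_on U f"
  shows "smooth_on U (\<lambda>x. L (f x))"
proof -
  \<comment> \<open>With the scalar 1 as first factor a linear map becomes a bilinear one.\<close>
  have "bounded_bilinear (\<lambda>(c::real) y. c *\<^sub>R L y)"
    by (rule bounded_bilinear.comp[OF bounded_bilinear_scaleR bounded_linear_ident assms(1)])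
  from smooth_on_bilinear[OF this assms(2) smooth_on_const[where c=1] assms(3)]
  show ?thesis by simp
qed

lemma smooth_on_add:
  "open U \<Longrightarrow> smooth_on U f \<Longrightarrow> smooth_on U g \<Longrightarrow> smooth_on U (\<lambda>x. f x + g x)"
  by (simp add: smooth_on_def times_differentiable_on_add)

lemma smooth_on_sum:
  assumes "open U" "\<And>i. i \<in> I \<Longrightarrow> smooth_on U (f i)"
  shows "smooth_on U (\<lambda>x. \<Sum>i\<in>I. f i x)"
  using assms(2)
  by (induction I rule: infinite_finite_induct) (auto intro!: smooth_on_add assms(1))

lemma smooth_on_mult:
  fixes f g :: "'a::real_normed_vector \<Rightarrow> real"
  shows "open U \<Longrightarrow> smooth_on U f \<Longrightarrow> smooth_on U g \<Longrightarrow> smooth_on U (\<lambda>x. f x * g x)"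
  by (rule smooth_on_bilinear[OF bounded_bilinear_mult])

lemma smooth_on_prod:
  fixes f :: "'i \<Rightarrow> 'a::real_normed_vector \<Rightarrow> real"
  assumes "open U" "\<And>i. i \<in> I \<Longrightarrow> smooth_on U (f i)"
  shows "smooth_on U (\<lambda>x. \<Prod>i\<in>I. f i x)"
  using assms(2)
  by (induction I rule: infinite_finite_induct) (auto intro!: smooth_on_mult assms(1))

lemma smooth_on_inverse:
  fixes f :: "'a::real_normed_vector \<Rightarrow> real"
  shows "open U \<Longrightarrow> smooth_on U f \<Longrightarrow> (\<And>x. x \<in> U \<Longrightarrow> f x \<noteq> 0) \<Longrightarrow>
    smooth_on U (\<lambda>x. inverse (f x))"
  by (simp add: smooth_on_def times_differentiable_on_inverse)

lemma smooth_on_powr: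
  fixes f :: "'a::real_normed_vector \<Rightarrow> real"
  shows "open U \<Longrightarrow> smooth_on U f \<Longrightarrow> (\<And>x. x \<in> U \<Longrightarrow> f x > 0) \<Longrightarrow> smooth_on U (\<lambda>x. f x powr a)"
  by (simp add: smooth_on_def times_differentiable_on_powr)

lemma smooth_on_dir_deriv: "smooth_on U f \<Longrightarrow> smooth_on U (\<lambda>x. dir_deriv f v x)"
  unfolding smooth_on_def using times_differentiable_on.simps(2) by blast

lemma smooth_on_differentiable: "smooth_on U f \<Longrightarrow> x \<in> U \<Longrightarrow> f differentiable (at x)"
  unfolding smooth_on_def using times_differentiable_on.simps(2) by blast

lemma smooth_on_has_derivative:
  "smooth_on U f \<Longrightarrow> x \<in> U \<Longrightarrow> (f has_derivative (\<lambda>v. dir_deriv f v x)) (at x)"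
  using smooth_on_differentiable frechet_derivative_works by blast

lemma smooth_on_linear_derivative:
  "smooth_on U f \<Longrightarrow> x \<in> U \<Longrightarrow> linear (\<lambda>v. dir_deriv f v x)"
  using smooth_on_differentiable linear_frechet_derivative by blast

lemma smooth_on_continuous: "smooth_on U f \<Longrightarrow> continuous_on U f"
  unfolding smooth_on_def using times_differentiable_on_continuous by blast

lemma dir_deriv_bilinear:
  assumes "bounded_bilinear B" "smooth_on U f" "smooth_on U g" "x \<in> U"
  shows "dir_deriv (\<lambda>x. B (f x) (g x)) v x = B (f x) (dir_deriv g v x) + B (dir_deriv f v x) (g x)"
  by (rule dir_deriv_eqI[OF bounded_bilinear.FDERIV[OF assms(1)]])
    (auto intro: smooth_on_has_derivative assms)

lemma dir_deriv_linear:
  assumes "bounded_linear L" "smooth_on U f" "x \<in> U"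
  shows "dir_deriv (\<lambda>x. L (f x)) v x = L (dir_deriv f v x)"
  by (rule dir_deriv_eqI[OF bounded_linear.has_derivative[OF assms(1)]])
    (auto intro: smooth_on_has_derivative assms)

text \<open>The vector is the sum of its components, each put into its slot by a bounded linear
  map.\<close>

lemma smooth_on_vec_lambda:
  fixes f :: "'i::finite \<Rightarrow> 'a::real_normed_vector \<Rightarrow> 'b::real_normed_vector"
  assumes "open U" "\<And>i. smooth_on U (f i)"
  shows "smooth_on U (\<lambda>x. \<chi> i. f i x)"
proof -
  have L: "bounded_linear (\<lambda>b::'b. \<chi> j. if j = i then b else 0)" for i :: 'i
  proof (rule bounded_linear_intro[where K=1])
    fix b :: 'b
    show "norm (\<chi> j. if j = i then b else 0) \<le> norm b * 1"
      by (simp add: norm_vec_def L2_set_def if_distrib[of norm] if_distrib[of "\<lambda>r. r\<^sup>2"] cong: if_cong)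
  qed (auto simp: vec_eq_iff)
  have "(\<lambda>x. \<chi> i. f i x) = (\<lambda>x. \<Sum>i\<in>UNIV. \<chi> j. if j = i then f i x else 0)"
    by (simp add: fun_eq_iff vec_eq_iff)
  then show ?thesis
    by (auto intro!: smooth_on_sum assms smooth_on_linear[OF L])
qed

lemma smooth_on_vec_nth:
  "open U \<Longrightarrow> smooth_on U f \<Longrightarrow> smooth_on U (\<lambda>x. f x $ i)"
  by (rule smooth_on_linear[OF bounded_linear_vec_nth])

text \<open>The mean value theorem is applied twice: in direction \<open>u\<close> to the increment
  of \<open>f\<close> along \<open>t v\<close>, then in direction \<open>v\<close> to the resulting
  difference of \<open>dir_deriv f u\<close>. The point found lies in the parallelogram spanned by
  \<open>t u\<close> and \<open>t v\<close>, which the ball contains.\<close>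

lemma second_difference_mvt:
  fixes f :: "'a::real_normed_vector \<Rightarrow> real"
  assumes U: "cball x (t * (norm u + norm v)) \<subseteq> U" and t: "t > 0"
    and f: "smooth_on U f"
  obtains y where "norm (y - x) \<le> t * (norm u + norm v)"
    "f (x + t *\<^sub>R u + t *\<^sub>R v) - f (x + t *\<^sub>R u) - f (x + t *\<^sub>R v) + f x =
      t\<^sup>2 * dir_deriv (\<lambda>y. dir_deriv f u y) v y"
proof -
  have bound: "norm (a *\<^sub>R u + b *\<^sub>R v) \<le> t * (norm u + norm v)"
    if "0 \<le> a" "a \<le> t" "0 \<le> b" "b \<le> t" for a b
  proof -
    have "norm (a *\<^sub>R u + b *\<^sub>R v) \<le> a * norm u + b * norm v"
      using norm_triangle_ineq[of "a *\<^sub>R u" "b *\<^sub>R v"] that by simp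
    also have "\<dots> \<le> t * norm u + t * norm v"
      using that by (intro add_mono mult_right_mono) auto
    finally show ?thesis by (simp add: algebra_simps)
  qed
  have inU: "x + a *\<^sub>R u + b *\<^sub>R v \<in> U" if "0 \<le> a" "a \<le> t" "0 \<le> b" "b \<le> t" for a b
  proof -
    have "dist x (x + a *\<^sub>R u + b *\<^sub>R v) = norm (a *\<^sub>R u + b *\<^sub>R v)"
      by (metis add.assoc add_diff_cancel_left' dist_commute dist_norm)
    then show ?thesis using U bound[OF that] by auto
  qed
  have line: "((\<lambda>s. F (z + s *\<^sub>R w)) has_derivative (\<lambda>r. r * dir_deriv F w (z + s *\<^sub>R w))) (at s)"
    if "z + s *\<^sub>R w \<in> U" "smooth_on U F" for F :: "'a \<Rightarrow> real" and z w s
  proof -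
    have "((\<lambda>s. z + s *\<^sub>R w) has_derivative (\<lambda>r. r *\<^sub>R w)) (at s)"
      by (auto intro!: derivative_eq_intros)
    from diff_chain_at[OF this smooth_on_has_derivative[OF that(2,1)]]
    show ?thesis
      using linear_cmul[OF smooth_on_linear_derivative[OF that(2,1)]] by (simp add: o_def)
  qed
  have "((\<lambda>s. f ((x + t *\<^sub>R v) + s *\<^sub>R u) - f (x + s *\<^sub>R u)) has_derivative
     (\<lambda>r. r * dir_deriv f u ((x + t *\<^sub>R v) + s *\<^sub>R u) - r * dir_deriv f u (x + s *\<^sub>R u))) (at s within {0..t})"
    if "0 \<le> s" "s \<le> t" for s
    using inU[of s t] inU[of s 0] that t
    by (intro has_derivative_at_withinI[OF has_derivative_diff] line f) (auto simp: algebra_simps)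
  from mvt_simple[OF t this] obtain s where s: "0 < s" "s < t" and
    1: "f (x + t *\<^sub>R v + t *\<^sub>R u) - f (x + t *\<^sub>R u) - (f (x + t *\<^sub>R v) - f x)
      = t * (dir_deriv f u (x + t *\<^sub>R v + s *\<^sub>R u) - dir_deriv f u (x + s *\<^sub>R u))"
    by (auto simp: algebra_simps)
  have "((\<lambda>r. dir_deriv f u ((x + s *\<^sub>R u) + r *\<^sub>R v)) has_derivative
     (\<lambda>h. h * dir_deriv (\<lambda>y. dir_deriv f u y) v ((x + s *\<^sub>R u) + r *\<^sub>R v))) (at r within {0..t})"
    if "0 \<le> r" "r \<le> t" for r
    using inU[of s r] that s
    by (intro has_derivative_at_withinI[OF line] smooth_on_dir_deriv f) auto
  from mvt_simple[OF t this] obtain r where r: "0 < r" "r < t" and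
    2: "dir_deriv f u (x + s *\<^sub>R u + t *\<^sub>R v) - dir_deriv f u (x + s *\<^sub>R u)
      = t * dir_deriv (\<lambda>y. dir_deriv f u y) v (x + s *\<^sub>R u + r *\<^sub>R v)"
    by auto
  show ?thesis
  proof (rule that[of "x + s *\<^sub>R u + r *\<^sub>R v"])
    show "norm (x + s *\<^sub>R u + r *\<^sub>R v - x) \<le> t * (norm u + norm v)"
      using bound[of s r] s r by (simp add: algebra_simps)
    show "f (x + t *\<^sub>R u + t *\<^sub>R v) - f (x + t *\<^sub>R u) - f (x + t *\<^sub>R v) + f x =
        t\<^sup>2 * dir_deriv (\<lambda>y. dir_deriv f u y) v (x + s *\<^sub>R u + r *\<^sub>R v)"
      using 1 2 by (simp add: algebra_simps power2_eq_square)
  qed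
qed

text \<open>The second difference is symmetric in \<open>u\<close> and \<open>v\<close>, so the two
  mixed derivatives take a common value at a pair of points arbitrarily near \<open>x\<close>;
  continuity makes them agree at \<open>x\<close>.\<close>

lemma dir_deriv_commute_real:
  fixes f :: "'a::real_normed_vector \<Rightarrow> real"
  assumes U: "open U" "x \<in> U" and f: "smooth_on U f"
  shows "dir_deriv (\<lambda>y. dir_deriv f u y) v x = dir_deriv (\<lambda>y. dir_deriv f v y) u x"
proof (rule ccontr)
  let ?a = "\<lambda>x. dir_deriv (\<lambda>y. dir_deriv f u y) v x"
  let ?b = "\<lambda>x. dir_deriv (\<lambda>y. dir_deriv f v y) u x"
  \<comment> \<open>Half of the gap: two errors below it cannot bridge the gap.\<close>
  define e where "e = \<bar>?a x - ?b x\<bar> / 2"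
  assume "?a x \<noteq> ?b x"
  then have e: "e > 0" by (simp add: e_def)
  have "continuous_on U ?a" "continuous_on U ?b"
    by (intro smooth_on_continuous smooth_on_dir_deriv f)+
  then have "isCont ?a x" "isCont ?b x"
    using U by (auto simp: continuous_on_eq_continuous_at)
  then obtain d1 d2 where d: "d1 > 0" "d2 > 0"
    "\<And>y. norm (y - x) < d1 \<Longrightarrow> \<bar>?a y - ?a x\<bar> < e" "\<And>y. norm (y - x) < d2 \<Longrightarrow> \<bar>?b y - ?b x\<bar> < e"
    using e unfolding continuous_at_eps_delta dist_norm real_norm_def by metis
  obtain r where r: "r > 0" "cball x r \<subseteq> U" using U open_contains_cball by blast
  define m where "m = min r (min d1 d2) / 2"
  have m: "m > 0" "m < d1" "m < d2" "m \<le> r" using d r by (auto simp: m_def)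
  \<comment> \<open>The summand 1 keeps the denominator positive when \<open>u\<close> and
    \<open>v\<close> are both 0.\<close>
  define t where "t = m / (norm u + norm v + 1)"
  have "norm u + norm v + 1 > 0" by (simp add: add_nonneg_pos)
  then have t: "t > 0" "t * (norm u + norm v) \<le> m"
    using m by (auto simp: t_def field_simps)
  then have cb: "cball x (t * (norm u + norm v)) \<subseteq> U" "cball x (t * (norm v + norm u)) \<subseteq> U"
    using r m by (auto simp: add.commute)
  obtain y where y: "norm (y - x) \<le> t * (norm u + norm v)"
    "f (x + t *\<^sub>R u + t *\<^sub>R v) - f (x + t *\<^sub>R u) - f (x + t *\<^sub>R v) + f x = t\<^sup>2 * ?a y"
    by (rule second_difference_mvt[OF cb(1) t(1) f])
  obtain z where z: "norm (z - x) \<le> t * (norm v + norm u)"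
    "f (x + t *\<^sub>R v + t *\<^sub>R u) - f (x + t *\<^sub>R v) - f (x + t *\<^sub>R u) + f x = t\<^sup>2 * ?b z"
    by (rule second_difference_mvt[OF cb(2) t(1) f])
  have "t\<^sup>2 * ?a y = t\<^sup>2 * ?b z"
    using y(2) z(2) by (simp add: algebra_simps)
  then have "?a y = ?b z" using t by simp
  moreover have "\<bar>?a y - ?a x\<bar> < e" using y(1) t m by (intro d(3)) linarith
  moreover have "\<bar>?b z - ?b x\<bar> < e" using z(1) t m by (intro d(4)) (simp add: add.commute)
  ultimately show False unfolding e_def by (simp add: abs_if field_simps split: if_splits)
qed

text \<open>Componentwise, because the mean value argument is for real values.\<close>

lemma dir_deriv_commute:
  fixes f :: "'a::real_normed_vector \<Rightarrow> 'b::euclidean_space"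
  assumes U: "open U" "x \<in> U" and f: "smooth_on U f"
  shows "dir_deriv (\<lambda>y. dir_deriv f u y) v x = dir_deriv (\<lambda>y. dir_deriv f v y) u x"
proof (rule euclidean_eqI)
  fix b :: 'b assume "b \<in> Basis"
  have L: "bounded_linear (\<lambda>y. y \<bullet> b)" by (rule bounded_linear_inner_left)
  have 1: "dir_deriv (\<lambda>y. dir_deriv f u y \<bullet> b) v x =
      dir_deriv (\<lambda>y. dir_deriv (\<lambda>z. f z \<bullet> b) u y) v x" for u v
    by (rule fun_cong[OF frechet_derivative_cong_open[OF U]]) (simp add: dir_deriv_linear[OF L f])
  have "dir_deriv (\<lambda>y. dir_deriv (\<lambda>z. f z \<bullet> b) u y) v x =
      dir_deriv (\<lambda>y. dir_deriv (\<lambda>z. f z \<bullet> b) v y) u x"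
    by (intro dir_deriv_commute_real[OF U] smooth_on_linear[OF L] U f)
  then show "dir_deriv (\<lambda>y. dir_deriv f u y) v x \<bullet> b = dir_deriv (\<lambda>y. dir_deriv f v y) u x \<bullet> b"
    using U f by (simp add: 1[symmetric] dir_deriv_linear[OF L smooth_on_dir_deriv])
qed

section \<open>Matrices\<close>

lemma matrix_inv:
  fixes A :: "real^'k^'k"
  assumes "det A \<noteq> 0"
  shows "A ** matrix_inv A = mat 1" "matrix_inv A ** A = mat 1"
proof -
  have "\<exists>B. A ** B = mat 1 \<and> B ** A = mat 1"
    using assms by (simp add: invertible_det_nz[symmetric] invertible_def)
  then have "A ** matrix_inv A = mat 1 \<and> matrix_inv A ** A = mat 1"
    unfolding matrix_inv_def by (rule someI_ex)
  then show "A ** matrix_inv A = mat 1" "matrix_inv A ** A = mat 1" by auto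
qed

lemma matrix_inv_unique:
  fixes A B :: "real^'k^'k"
  assumes "A ** B = mat 1"
  shows "matrix_inv A = B"
proof -
  have "det A * det B = 1" using assms by (metis det_I det_mul)
  then have "matrix_inv A ** A = mat 1" by (intro matrix_inv) auto
  then show ?thesis by (metis assms matrix_mul_assoc matrix_mul_lid matrix_mul_rid)
qed

lemma matrix_inv_vector:
  fixes A :: "real^'k^'k"
  assumes "det A \<noteq> 0"
  shows "matrix_inv A *v (A *v v) = v" "A *v (matrix_inv A *v v) = v"
  using matrix_inv[OF assms] by (simp_all add: matrix_vector_mul_assoc)

lemma det_matrix_inv:
  fixes A :: "real^'k^'k"
  assumes "det A \<noteq> 0"
  shows "det (matrix_inv A) = inverse (det A)"
  using matrix_inv(1)[OF assms] assms by (metis det_I det_mul inverse_unique)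

lemma transpose_matrix_inv:
  fixes A :: "real^'k^'k"
  assumes "det A \<noteq> 0"
  shows "transpose (matrix_inv A) = matrix_inv (transpose A)"
  using matrix_inv(2)[OF assms]
  by (intro matrix_inv_unique[symmetric]) (metis matrix_transpose_mul transpose_mat)

lemma bounded_bilinear_matrix_mult:
  "bounded_bilinear ((**) :: real^'b::finite^'a::finite \<Rightarrow> real^'c::finite^'b \<Rightarrow> real^'c^'a)"
  unfolding bilinear_conv_bounded_bilinear[symmetric] bilinear_def linear_iff
  by (simp add: vec_eq_iff matrix_matrix_mult_def sum.distrib algebra_simps sum_distrib_left)

lemma bounded_bilinear_matrix_vector_mult:
  "bounded_bilinear ((*v) :: real^'b::finite^'a::finite \<Rightarrow> real^'b \<Rightarrow> real^'a)"
  unfolding bilinear_conv_bounded_bilinear[symmetric] bilinear_def linear_iff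
  by (simp add: vec_eq_iff matrix_vector_mult_def sum.distrib algebra_simps sum_distrib_left)

lemmas matrix_mult_simps =
  bounded_bilinear.add_left[OF bounded_bilinear_matrix_mult]
  bounded_bilinear.add_right[OF bounded_bilinear_matrix_mult]
  bounded_bilinear.diff_left[OF bounded_bilinear_matrix_mult]
  bounded_bilinear.diff_right[OF bounded_bilinear_matrix_mult]
  bounded_bilinear.scaleR_left[OF bounded_bilinear_matrix_mult]
  bounded_bilinear.scaleR_right[OF bounded_bilinear_matrix_mult]
  bounded_bilinear.minus_left[OF bounded_bilinear_matrix_mult]
  bounded_bilinear.minus_right[OF bounded_bilinear_matrix_mult]
  bounded_bilinear.zero_left[OF bounded_bilinear_matrix_mult]
  bounded_bilinear.zero_right[OF bounded_bilinear_matrix_mult]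

lemmas matrix_vector_mult_simps =
  bounded_bilinear.add_left[OF bounded_bilinear_matrix_vector_mult]
  bounded_bilinear.add_right[OF bounded_bilinear_matrix_vector_mult]
  bounded_bilinear.diff_left[OF bounded_bilinear_matrix_vector_mult]
  bounded_bilinear.diff_right[OF bounded_bilinear_matrix_vector_mult]
  bounded_bilinear.scaleR_left[OF bounded_bilinear_matrix_vector_mult]
  bounded_bilinear.scaleR_right[OF bounded_bilinear_matrix_vector_mult]
  bounded_bilinear.minus_left[OF bounded_bilinear_matrix_vector_mult]
  bounded_bilinear.minus_right[OF bounded_bilinear_matrix_vector_mult]
  bounded_bilinear.zero_left[OF bounded_bilinear_matrix_vector_mult]
  bounded_bilinear.zero_right[OF bounded_bilinear_matrix_vector_mult]

lemma bounded_linear_transpose: "bounded_linear (transpose :: real^'b::finite^'a::finite \<Rightarrow> real^'a^'b)"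
  by (intro linear_conv_bounded_linear[THEN iffD1] linearI)
    (simp_all add: vec_eq_iff transpose_def)

lemma bounded_linear_trace: "bounded_linear (trace :: real^'k::finite^'k \<Rightarrow> real)"
  by (intro linear_conv_bounded_linear[THEN iffD1] linearI)
    (simp_all add: trace_def sum.distrib sum_distrib_left)

lemmas transpose_simps =
  linear_add[OF bounded_linear.linear[OF bounded_linear_transpose]]
  linear_diff[OF bounded_linear.linear[OF bounded_linear_transpose]]
  linear_neg[OF bounded_linear.linear[OF bounded_linear_transpose]]
  linear_cmul[OF bounded_linear.linear[OF bounded_linear_transpose]]
  linear_0[OF bounded_linear.linear[OF bounded_linear_transpose]]

lemmas trace_simps =
  linear_add[OF bounded_linear.linear[OF bounded_linear_trace]]
  linear_diff[OF bounded_linear.linear[OF bounded_linear_trace]]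
  linear_neg[OF bounded_linear.linear[OF bounded_linear_trace]]
  linear_cmul[OF bounded_linear.linear[OF bounded_linear_trace]]
  linear_0[OF bounded_linear.linear[OF bounded_linear_trace]]

lemma trace_transpose_mult_self: "trace (transpose A ** A) = A \<bullet> (A :: real^'k::finite^'k)"
  unfolding trace_def transpose_def matrix_matrix_mult_def inner_vec_def
  by simp (rule sum.swap)

section \<open>Smoothness and derivatives of determinants and inverses\<close>

lemma smooth_on_det:
  fixes A :: "'a::real_normed_vector \<Rightarrow> real^'k::finite^'k"
  assumes "open U" "smooth_on U A"
  shows "smooth_on U (\<lambda>x. det (A x))"
  unfolding det_def
  by (intro smooth_on_sum smooth_on_mult smooth_on_prod smooth_on_vec_nth smooth_on_const assms)

text \<open>Cramer's rule writes the entries as quotients of polynomials in \<open>A\<close>, from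
  which smoothness of inversion is obtained.\<close>

lemma matrix_inv_cramer:
  fixes A :: "real^'k::finite^'k"
  assumes "det A \<noteq> 0"
  shows "matrix_inv A = (\<chi> k l. det (\<chi> i j. if j = k then axis l 1 $ i else A $ i $ j) * inverse (det A))"
proof -
  have "matrix_inv A $ k $ l = det (\<chi> i j. if j = k then axis l 1 $ i else A $ i $ j) * inverse (det A)"
    for k l
  proof -
    have "A *v (matrix_inv A *v axis l 1) = axis l 1"
      by (rule matrix_inv_vector(2)[OF assms])
    then have "matrix_inv A *v axis l 1 =
        (\<chi> k. det(\<chi> i j. if j = k then axis l 1 $ i else A $ i $ j) / det A)"
      by (simp add: cramer[OF assms])
    then have "(matrix_inv A *v axis l 1) $ k =
        det(\<chi> i j. if j = k then axis l 1 $ i else A $ i $ j) / det A"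
      by simp
    then show ?thesis
      by (simp add: matrix_vector_mult_basis column_def divide_inverse)
  qed
  then show ?thesis by (simp add: vec_eq_iff)
qed

lemma smooth_on_matrix_inv:
  fixes A :: "'a::real_normed_vector \<Rightarrow> real^'k::finite^'k"
  assumes "open U" "smooth_on U A" "\<And>x. x \<in> U \<Longrightarrow> det (A x) \<noteq> 0"
  shows "smooth_on U (\<lambda>x. matrix_inv (A x))"
proof (rule smooth_on_cong[OF assms(1)])
  show "(\<chi> k l. det (\<chi> i j. if j = k then axis l 1 $ i else A x $ i $ j) * inverse (det (A x)))
      = matrix_inv (A x)" if "x \<in> U" for x
    by (rule matrix_inv_cramer[symmetric]) (rule assms(3)[OF that])
  have "smooth_on U (\<lambda>x. if j = k then axis l (1::real) $ i else A x $ i $ j)" for i j k l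
    by (cases "j = k") (auto intro!: smooth_on_vec_nth[OF _ smooth_on_vec_nth] assms)
  then show "smooth_on U
      (\<lambda>x. \<chi> k l. det (\<chi> i j. if j = k then axis l 1 $ i else A x $ i $ j) * inverse (det (A x)))"
    by (intro smooth_on_vec_lambda smooth_on_mult smooth_on_inverse smooth_on_det assms)
qed

text \<open>In the Leibniz formula each term of the derivative replaces one factor. A permutation
  other than the identity moves at least two indices, so a zero entry of \<open>mat 1\<close>
  survives among the other factors; only the identity contributes.\<close>

lemma has_derivative_det_mat_1:
  "((det :: real^'k::finite^'k \<Rightarrow> real) has_derivative trace) (at (mat 1))"
proof -
  let ?P = "{p. p permutes (UNIV :: 'k set)}"
  have nth: "((\<lambda>A::real^'k^'k. A $ i $ j) has_derivative (\<lambda>A. A $ i $ j)) (at (mat 1))" for i j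
    by (intro bounded_linear_imp_has_derivative bounded_linear_compose[OF bounded_linear_vec_nth]
        bounded_linear_vec_nth)
  have "((\<lambda>A::real^'k^'k. \<Sum>p\<in>?P. of_int (sign p) * (\<Prod>i\<in>UNIV. A $ i $ p i)) has_derivative
    (\<lambda>H. \<Sum>p\<in>?P. of_int (sign p) *
      (\<Sum>i\<in>UNIV. H $ i $ p i * (\<Prod>j\<in>UNIV - {i}. (mat 1 :: real^'k^'k) $ j $ p j)))) (at (mat 1))"
    by (intro has_derivative_sum has_derivative_mult_right has_derivative_prod nth)
  moreover have "(\<Sum>p\<in>?P. of_int (sign p) *
      (\<Sum>i\<in>UNIV. H $ i $ p i * (\<Prod>j\<in>UNIV - {i}. (mat 1 :: real^'k^'k) $ j $ p j))) = trace H"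
    for H :: "real^'k^'k"
  proof -
    have "(\<Sum>p\<in>?P. of_int (sign p) *
        (\<Sum>i\<in>UNIV. H $ i $ p i * (\<Prod>j\<in>UNIV - {i}. (mat 1 :: real^'k^'k) $ j $ p j)))
      = (\<Sum>p\<in>{id}. of_int (sign p) *
        (\<Sum>i\<in>UNIV. H $ i $ p i * (\<Prod>j\<in>UNIV - {i}. (mat 1 :: real^'k^'k) $ j $ p j)))"
    proof (rule sum.mono_neutral_right)
      show "\<forall>p\<in>?P - {id}. of_int (sign p) *
        (\<Sum>i\<in>UNIV. H $ i $ p i * (\<Prod>j\<in>UNIV - {i}. (mat 1 :: real^'k^'k) $ j $ p j)) = 0"
      proof
        fix p assume p: "p \<in> ?P - {id}"
        have prod_0: "(\<Prod>j\<in>UNIV - {i}. (mat 1 :: real^'k^'k) $ j $ p j) = 0" for i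
        proof -
          have "\<exists>j. j \<noteq> i \<and> p j \<noteq> j"
          proof (rule ccontr)
            assume *: "\<not> ?thesis"
            then have "p j = j" if "j \<noteq> i" for j using that by blast
            moreover have "p i = i"
              using p * by (metis DiffD1 mem_Collect_eq permutes_inj injD)
            ultimately have "p = id" by fastforce
            then show False using p by simp
          qed
          then have "\<exists>j\<in>UNIV - {i}. (mat 1 :: real^'k^'k) $ j $ p j = 0"
            by (auto simp: mat_def) (metis DiffI UNIV_I singletonD)
          then show ?thesis by (intro prod_zero) auto
        qed
        show "of_int (sign p) *
          (\<Sum>i\<in>UNIV. H $ i $ p i * (\<Prod>j\<in>UNIV - {i}. (mat 1 :: real^'k^'k) $ j $ p j)) = 0"
          by (simp only: prod_0 mult_zero_right sum.neutral_const)
      qed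
    qed (auto simp: finite_permutations permutes_id)
    also have "\<dots> = trace H" by (simp add: trace_def mat_def)
    finally show ?thesis .
  qed
  ultimately show ?thesis by (simp add: det_def[abs_def])
qed

text \<open>Jacobi's formula, reduced to the identity matrix by writing det A(y) as det A(x) times
  det(A(x)^-1 A(y)).\<close>

lemma has_derivative_det:
  fixes A :: "'a::real_normed_vector \<Rightarrow> real^'k::finite^'k"
  assumes A: "(A has_derivative A') (at x)" and d: "det (A x) \<noteq> 0"
  shows "((\<lambda>y. det (A y)) has_derivative (\<lambda>v. det (A x) * trace (matrix_inv (A x) ** A' v))) (at x)"
proof -
  let ?M = "matrix_inv (A x)"
  have "((\<lambda>y. ?M ** A y) has_derivative (\<lambda>v. ?M ** A' v)) (at x)"
    by (rule bounded_linear.has_derivative[OF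
        bounded_bilinear.bounded_linear_right[OF bounded_bilinear_matrix_mult] A])
  from diff_chain_at[OF this, of det trace]
  have "((\<lambda>y. det (?M ** A y)) has_derivative (\<lambda>v. trace (?M ** A' v))) (at x)"
    using has_derivative_det_mat_1 by (simp add: matrix_inv[OF d] o_def)
  then have "((\<lambda>y. det (A x) * det (?M ** A y)) has_derivative
      (\<lambda>v. det (A x) * trace (?M ** A' v))) (at x)"
    by (rule has_derivative_mult_right)
  moreover have "det (A x) * det (?M ** B) = det B" for B
    using d by (simp add: det_mul det_matrix_inv)
  ultimately show ?thesis by simp
qed

text \<open>Differentiate A^-1 A = 1 and solve for the derivative of the inverse.\<close>

lemma dir_deriv_matrix_inv:
  fixes A :: "'a::real_normed_vector \<Rightarrow> real^'k::finite^'k"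
  assumes U: "open U" "x \<in> U" and A: "smooth_on U A" "\<And>x. x \<in> U \<Longrightarrow> det (A x) \<noteq> 0"
  shows "dir_deriv (\<lambda>x. matrix_inv (A x)) v x =
    - (matrix_inv (A x) ** dir_deriv A v x ** matrix_inv (A x))"
proof -
  let ?D = "dir_deriv (\<lambda>x. matrix_inv (A x)) v x"
  note inv = smooth_on_matrix_inv[OF U(1) A]
  have "dir_deriv (\<lambda>x. matrix_inv (A x) ** A x) v x = dir_deriv (\<lambda>x. mat 1) v x"
    by (rule fun_cong[OF frechet_derivative_cong_open[OF U]]) (simp add: matrix_inv A)
  then have "?D ** A x = - (matrix_inv (A x) ** dir_deriv A v x)"
    by (simp add: dir_deriv_bilinear[OF bounded_bilinear_matrix_mult inv A(1) U(2)]
        add_eq_0_iff)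
  then have "?D ** A x ** matrix_inv (A x) = - (matrix_inv (A x) ** dir_deriv A v x) ** matrix_inv (A x)"
    by simp
  then show ?thesis
    by (simp add: matrix_mul_assoc[symmetric] matrix_inv A(2)[OF U(2)] matrix_mult_simps)
qed

section \<open>Scalar products and orthonormal frames\<close>

lemma scalar_prod_transform: "scalar_prod Q (P *v v) (P *v w) = scalar_prod (transpose P ** Q ** P) v w"
  by (simp add: scalar_prod_def matrix_vector_mul_assoc[symmetric] dot_lmul_matrix[symmetric] inner_commute
      del: transpose_matrix_vector)

lemma scalar_prod_axis: "scalar_prod (Q :: real^'k::finite^'k) (axis i 1) (axis j 1) = Q $ i $ j"
  by (simp add: scalar_prod_def matrix_vector_mult_basis column_def inner_axis')

lemma bounded_bilinear_scalar_prod: "bounded_bilinear (scalar_prod (Q :: real^'k::finite^'k))"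
  unfolding bilinear_conv_bounded_bilinear[symmetric] bilinear_def linear_iff
  by (simp add: scalar_prod_def matrix_vector_mult_simps inner_simps)

lemmas scalar_prod_simps =
  bounded_bilinear.add_left[OF bounded_bilinear_scalar_prod]
  bounded_bilinear.add_right[OF bounded_bilinear_scalar_prod]
  bounded_bilinear.diff_left[OF bounded_bilinear_scalar_prod]
  bounded_bilinear.diff_right[OF bounded_bilinear_scalar_prod]
  bounded_bilinear.scaleR_left[OF bounded_bilinear_scalar_prod]
  bounded_bilinear.scaleR_right[OF bounded_bilinear_scalar_prod]
  bounded_bilinear.minus_left[OF bounded_bilinear_scalar_prod]
  bounded_bilinear.minus_right[OF bounded_bilinear_scalar_prod]
  bounded_bilinear.zero_left[OF bounded_bilinear_scalar_prod]
  bounded_bilinear.zero_right[OF bounded_bilinear_scalar_prod]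
  bounded_bilinear.sum_left[OF bounded_bilinear_scalar_prod]
  bounded_bilinear.sum_right[OF bounded_bilinear_scalar_prod]

lemma scalar_prod_commute:
  "transpose Q = Q \<Longrightarrow> scalar_prod Q v w = scalar_prod (Q :: real^'k::finite^'k) w v"
  by (metis scalar_prod_def dot_lmul_matrix inner_commute transpose_matrix_vector)

text \<open>A \<open>Q\<close>-orthonormal set of greatest size must span, since otherwise one
  Gram-Schmidt step adds a vector. Its elements become the columns of \<open>P\<close>.\<close>

lemma exists_orthonormal_frame:
  fixes Q :: "real^'k::finite^'k"
  assumes sym: "transpose Q = Q" and pos: "\<And>v. v \<noteq> 0 \<Longrightarrow> scalar_prod Q v v > 0"
  obtains P :: "real^'k^'k" where "transpose P ** Q ** P = mat 1"
proof -
  define orth where "orth S \<longleftrightarrow> (\<forall>a\<in>S. \<forall>b\<in>S. scalar_prod Q a b = (if a = b then 1 else 0))"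
    for S :: "(real^'k) set"
  have indep: "independent S" if "orth S" for S
    unfolding independent_explicit_module
  proof (intro allI impI)
    fix t :: "(real^'k) set" and u v
    assume t: "finite t" "t \<subseteq> S" "(\<Sum>v\<in>t. u v *\<^sub>R v) = 0" "v \<in> t"
    have "0 = scalar_prod Q (\<Sum>v\<in>t. u v *\<^sub>R v) v" using t by (simp add: scalar_prod_simps)
    also have "\<dots> = (\<Sum>w\<in>t. u w * (if w = v then 1 else 0))"
      unfolding scalar_prod_simps
      using that subsetD[OF t(2)] t(4) by (intro sum.cong refl) (simp add: orth_def)
    also have "\<dots> = u v" using t(1,4) by (simp add: if_distrib[of "(*) _"] cong: if_cong)
    finally show "u v = 0" by simp
  qed
  have card: "finite S \<and> card S \<le> CARD('k)" if "orth S" for S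
    using indep[OF that] independent_bound by fastforce
  \<comment> \<open>Independence bounds the size by the dimension, so a greatest size
    exists.\<close>
  have "\<exists>S. orth S \<and> (\<forall>S'. orth S' \<longrightarrow> card S' \<le> card S)"
  proof (rule ex_has_greatest_nat[of orth "{}" card "Suc CARD('k)"])
    show "orth {}" by (simp add: orth_def)
    show "\<forall>S. orth S \<longrightarrow> card S < Suc CARD('k)" using card by (simp add: less_Suc_eq_le)
  qed
  then obtain S where S: "orth S" "\<And>S'. orth S' \<Longrightarrow> card S' \<le> card S" by blast
  have fin: "finite S" using card S(1) by blast
  have span: "span S = UNIV"
  proof (rule ccontr)
    assume "span S \<noteq> UNIV"
    then obtain v where v: "v \<notin> span S" by blast
    \<comment> \<open>The part of \<open>v\<close> that is \<open>Q\<close>-orthogonal to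
      \<open>S\<close>.\<close>
    define w where "w = v - (\<Sum>s\<in>S. scalar_prod Q v s *\<^sub>R s)"
    have "(\<Sum>s\<in>S. scalar_prod Q v s *\<^sub>R s) \<in> span S"
      by (intro span_sum span_scale span_base)
    then have "w \<noteq> 0" using v unfolding w_def by (metis eq_iff_diff_eq_0)
    then have "scalar_prod Q w w > 0" by (rule pos)
    have ws: "scalar_prod Q w s = 0" if "s \<in> S" for s
    proof -
      have "scalar_prod Q (\<Sum>s\<in>S. scalar_prod Q v s *\<^sub>R s) s
          = (\<Sum>r\<in>S. scalar_prod Q v r * (if r = s then 1 else 0))"
        unfolding scalar_prod_simps using S(1) that by (intro sum.cong) (auto simp: orth_def)
      then show ?thesis using that fin
        by (simp add: w_def scalar_prod_simps if_distrib[of "(*) _"] cong: if_cong)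
    qed
    define e where "e = inverse (sqrt (scalar_prod Q w w)) *\<^sub>R w"
    have "scalar_prod Q e e = 1"
      using \<open>scalar_prod Q w w > 0\<close>
      by (simp add: e_def scalar_prod_simps field_simps)
    moreover have es: "scalar_prod Q e s = 0" "scalar_prod Q s e = 0" if "s \<in> S" for s
      using ws[OF that] scalar_prod_commute[OF sym, of s e] by (simp_all add: e_def scalar_prod_simps)
    ultimately have "e \<notin> S" by auto
    have "orth (insert e S)"
      using S(1) es \<open>scalar_prod Q e e = 1\<close> \<open>e \<notin> S\<close> by (auto simp: orth_def)
    from S(2)[OF this] show False using fin \<open>e \<notin> S\<close> by simp
  qed
  have "card S = CARD('k)"
    using dim_eq_card_independent[OF indep[OF S(1)]] dim_span[of S] span by simp
  then obtain e where e: "bij_betw e (UNIV :: 'k set) S"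
    using fin by (metis bij_betw_iff_card finite_code)
  define P :: "real^'k^'k" where "P = (\<chi> a i. e i $ a)"
  have col: "P *v axis i 1 = e i" for i
    by (simp add: P_def matrix_vector_mult_basis column_def)
  have "(transpose P ** Q ** P) $ i $ j = (mat 1 :: real^'k^'k) $ i $ j" for i j
  proof -
    have "(transpose P ** Q ** P) $ i $ j = scalar_prod Q (e i) (e j)"
      using scalar_prod_transform[of Q P "axis i 1" "axis j 1"] by (simp add: scalar_prod_axis col)
    moreover have "e i \<in> S" "e j \<in> S" "e i = e j \<longleftrightarrow> i = j"
      using e by (auto simp: bij_betw_def inj_on_def)
    ultimately show ?thesis using S(1) by (auto simp: orth_def mat_def)
  qed
  then show thesis by (intro that[of P]) (simp add: vec_eq_iff)
qed

section \<open>The Killing metric\<close>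

text \<open>Independence of the trace from the orthonormal basis. Stating it by expansion formulas
  covers both a set of vectors and the family of matrix units indexed by pairs.\<close>

lemma sum_inner_independent:
  fixes b :: "'i \<Rightarrow> 'a::real_inner" and c :: "'j \<Rightarrow> 'a"
  assumes "linear T"
    and b: "\<And>x. x = (\<Sum>i\<in>I. (x \<bullet> b i) *\<^sub>R b i)" and c: "\<And>x. x = (\<Sum>j\<in>J. (x \<bullet> c j) *\<^sub>R c j)"
  shows "(\<Sum>i\<in>I. b i \<bullet> T (b i)) = (\<Sum>j\<in>J. c j \<bullet> T (c j))"
proof -
  have "(\<Sum>i\<in>I. b i \<bullet> T (b i)) = (\<Sum>i\<in>I. \<Sum>j\<in>J. (b i \<bullet> c j) * (c j \<bullet> T (b i)))"
  proof (rule sum.cong[OF refl])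
    fix i
    have "b i \<bullet> T (b i) = (\<Sum>j\<in>J. (b i \<bullet> c j) *\<^sub>R c j) \<bullet> T (b i)"
      using c[of "b i"] by simp
    then show "b i \<bullet> T (b i) = (\<Sum>j\<in>J. (b i \<bullet> c j) * (c j \<bullet> T (b i)))"
      by (simp add: inner_sum_left)
  qed
  also have "\<dots> = (\<Sum>j\<in>J. \<Sum>i\<in>I. (b i \<bullet> c j) * (c j \<bullet> T (b i)))" by (rule sum.swap)
  also have "\<dots> = (\<Sum>j\<in>J. c j \<bullet> T (c j))"
  proof (rule sum.cong[OF refl])
    fix j
    have "T (c j) = T (\<Sum>i\<in>I. (c j \<bullet> b i) *\<^sub>R b i)"
      using b[of "c j"] by simp
    then show "(\<Sum>i\<in>I. (b i \<bullet> c j) * (c j \<bullet> T (b i))) = c j \<bullet> T (c j)"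
      by (simp add: linear_sum[OF assms(1)] linear_cmul[OF assms(1)] inner_sum_right inner_commute)
  qed
  finally show ?thesis .
qed

lemma inner_matrix_unit: "axis i (axis j 1) \<bullet> (X :: real^'k::finite^'k) = X $ i $ j"
  by (simp add: inner_axis')

text \<open>The diagonal coefficient of E -> A E B at a matrix unit. Summed over \<open>i\<close>
  and \<open>j\<close> it gives tr A tr B.\<close>

lemma matrix_mult_unit_nth:
  "(A ** axis i (axis j 1) ** B) $ i $ j = (A :: real^'k::finite^'k) $ i $ i * B $ j $ j"
  by (simp add: matrix_matrix_mult_def axis_def if_distrib[of "\<lambda>v. v $ _"] if_distrib[of "(*) _"]
      if_distrib[of "\<lambda>v. v * _"] cong: if_cong)

lemma matrix_unit_expansion:
  "X = (\<Sum>p\<in>UNIV. (X \<bullet> axis (fst p) (axis (snd p) 1)) *\<^sub>R axis (fst p) (axis (snd p) (1::real)))"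
  for X :: "real^'k::finite^'k"
proof -
  have "(\<Sum>p\<in>UNIV. (X \<bullet> axis (fst p) (axis (snd p) 1)) *\<^sub>R axis (fst p) (axis (snd p) (1::real)))
      $ a $ b = X $ a $ b" for a b
  proof -
    have "{p. a = fst p} \<inter> {p. b = snd p} = {(a, b)}" by auto
    then show ?thesis
      unfolding inner_commute[of X] inner_matrix_unit
      by (simp add: axis_def if_distrib[of "\<lambda>v. v $ _"] if_distrib[of "(*) _"]
          sum.If_cases cong: if_cong)
  qed
  then show ?thesis by (simp add: vec_eq_iff)
qed

lemma linear_lie_bracket: "linear (lie_bracket (X :: real^'k::finite^'k))"
  unfolding lie_bracket_def by (rule linearI) (simp_all add: matrix_mult_simps algebra_simps)

text \<open>The brackets annihilate the identity matrix, so adding the normalized identity to an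
  orthonormal basis of \<open>sl_algebra\<close> leaves the sum unchanged and turns it into a trace
  over all matrices, which the matrix units make computable.\<close>

lemma killing_form_eq:
  fixes X Y :: "real^'k::finite^'k"
  shows "killing_form X Y = 2 * CARD('k) * trace (X ** Y) - 2 * trace X * trace Y"
proof -
  let ?T = "lie_bracket X \<circ> lie_bracket Y"
  let ?P = "\<lambda>B. B \<subseteq> sl_algebra \<and> pairwise orthogonal B \<and> (\<forall>b\<in>B. norm b = 1) \<and>
    span B = (sl_algebra :: (real^'k^'k) set)"
  define B where "B = (SOME B. ?P B)"
  have T: "linear ?T" by (intro linear_compose linear_lie_bracket)
  have "subspace (sl_algebra :: (real^'k^'k) set)"
    by (simp add: subspace_def sl_algebra_def trace_simps)
  then have "\<exists>B. ?P B" by (metis orthonormal_basis_subspace)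
  then have B: "?P B" unfolding B_def by (rule someI_ex)
  \<comment> \<open>The identity has norm sqrt k, where k is the size of the matrices, and it is
    orthogonal to every trace-free matrix.\<close>
  define e where "e = inverse (sqrt (CARD('k))) *\<^sub>R (mat 1 :: real^'k^'k)"
  have inner_1: "X \<bullet> mat 1 = trace X" "mat 1 \<bullet> X = trace X" for X :: "real^'k^'k"
    by (simp_all add: inner_vec_def mat_def trace_def if_distrib[of "(*) _"] if_distrib[of "\<lambda>v. v * _"]
        cong: if_cong)
  have ee: "e \<bullet> e = 1"
    by (simp add: e_def inner_1 trace_I trace_simps field_simps)
  have be: "b \<bullet> e = 0" "e \<bullet> b = 0" if "b \<in> sl_algebra" for b
    using that by (simp_all add: e_def inner_1 sl_algebra_def)
  have fin: "finite B" using B by (intro pairwise_orthogonal_imp_finite) auto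
  have "e \<notin> B" using B be(1)[of e] ee by auto
  let ?B = "insert e B"
  have "x \<in> span ?B" for x
  proof -
    have "trace (x - (x \<bullet> e) *\<^sub>R e) = 0"
      by (simp add: trace_simps e_def inner_1 trace_I field_simps)
    then have "x - (x \<bullet> e) *\<^sub>R e \<in> span B" using B by (simp add: sl_algebra_def)
    then show ?thesis by (meson span_breakdown_eq)
  qed
  moreover have "pairwise orthogonal ?B"
    using B be by (auto simp: pairwise_insert orthogonal_def subset_iff)
  moreover have "norm b = 1" if "b \<in> ?B" for b
    using that B ee by (auto simp: norm_eq_1)
  ultimately have "x = (\<Sum>b\<in>?B. (x \<bullet> b) *\<^sub>R b)" for x
    using fin by (intro orthonormal_basis_expand[symmetric]) auto
  from sum_inner_independent[OF T this matrix_unit_expansion]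
  have "(\<Sum>b\<in>?B. b \<bullet> ?T b) =
      (\<Sum>p\<in>UNIV. axis (fst p) (axis (snd p) 1) \<bullet> ?T (axis (fst p) (axis (snd p) 1)))"
    by simp
  moreover have "?T e = 0"
    by (simp add: e_def lie_bracket_def matrix_mult_simps)
  ultimately have "killing_form X Y =
      (\<Sum>p\<in>UNIV. axis (fst p) (axis (snd p) 1) \<bullet> ?T (axis (fst p) (axis (snd p) 1)))"
    using fin \<open>e \<notin> B\<close> unfolding killing_form_def endo_trace_def Let_def B_def[symmetric] by simp
  also have "\<dots> = (\<Sum>i\<in>UNIV. \<Sum>j\<in>UNIV. (X ** Y) $ i $ i - X $ i $ i * Y $ j $ j
      - Y $ i $ i * X $ j $ j + (Y ** X) $ j $ j)"
  proof -
    have "(?T (axis i (axis j 1))) $ i $ j = (X ** Y) $ i $ i - X $ i $ i * Y $ j $ j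
      - Y $ i $ i * X $ j $ j + (Y ** X) $ j $ j" for i j
    proof -
      let ?E = "axis i (axis j 1) :: real^'k^'k"
      \<comment> \<open>The factors \<open>mat 1\<close> give all four terms the shape A E
        B.\<close>
      have "?T ?E = (X ** Y) ** ?E ** mat 1 - X ** ?E ** Y - Y ** ?E ** X + mat 1 ** ?E ** (Y ** X)"
        by (simp add: lie_bracket_def matrix_mult_simps matrix_mul_assoc)
      then show ?thesis by (simp add: matrix_mult_unit_nth mat_def)
    qed
    then show ?thesis
      unfolding inner_matrix_unit by (simp add: sum.cartesian_product case_prod_unfold)
  qed
  also have "\<dots> = 2 * CARD('k) * trace (X ** Y) - 2 * trace X * trace Y"
    unfolding trace_mul_sym[of Y X, symmetric]
    by (simp add: sum.distrib sum_subtractf trace_def sum_product[symmetric] sum_distrib_left[symmetric]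
        sum_distrib_right[symmetric] flip: trace_def)
      (simp add: trace_mul_sym[of Y X] flip: trace_def)
  finally show ?thesis .
qed

section \<open>Scalar products of determinant 1 as an orbit, and the invariant metric on
  them\<close>

lemma sym_spaceD:
  assumes "Q \<in> sym_space"
  shows "transpose Q = Q" "\<And>v. v \<noteq> 0 \<Longrightarrow> scalar_prod Q v v > 0" "det Q = 1"
  using assms by (auto simp: sym_space_def)

lemma transpose_matrix_inv_sym_space:
  "Q \<in> sym_space \<Longrightarrow> transpose (matrix_inv Q) = matrix_inv Q"
  by (simp add: transpose_matrix_inv sym_spaceD)

lemma scalar_prod_orbit_map:
  "scalar_prod (orbit_map g) v w = (matrix_inv g *v v) \<bullet> (matrix_inv g *v (w :: real^'k::finite))"
  using scalar_prod_transform[of "mat 1" "matrix_inv g" v w]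
  by (simp add: orbit_map_def) (simp add: scalar_prod_def)

text \<open>The determinant may be -1: the frame matrices of the affine sphere are unimodular only
  up to sign.\<close>

lemma orbit_map_sym_space:
  fixes g :: "real^'k::finite^'k"
  assumes "\<bar>det g\<bar> = 1"
  shows "orbit_map g \<in> sym_space"
proof -
  have g: "det g \<noteq> 0" using assms by auto
  have "det g * det g = 1" using assms by (metis abs_mult_self_eq mult_1)
  have "scalar_prod (orbit_map g) v v > 0" if "v \<noteq> 0" for v
  proof -
    have "matrix_inv g *v v \<noteq> 0"
      using matrix_inv_vector(2)[OF g, of v] that by force
    then show ?thesis by (simp add: scalar_prod_orbit_map)
  qed
  then show ?thesis
    using \<open>det g * det g = 1\<close> g unfolding sym_space_def
    by (simp add: orbit_map_def matrix_transpose_mul det_mul det_matrix_inv field_simps)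
qed

lemma matrix_inv_congruence:
  fixes g :: "real^'k::finite^'k"
  assumes "det g \<noteq> 0"
  shows "transpose (matrix_inv g) ** (transpose g ** H ** g) ** matrix_inv g = H"
proof -
  have "transpose (matrix_inv g) ** transpose g = mat 1" "g ** matrix_inv g = mat 1"
    using matrix_inv[OF assms] by (metis matrix_transpose_mul transpose_mat)+
  then show ?thesis by (metis matrix_mul_assoc matrix_mul_lid matrix_mul_rid)
qed

lemma matrix_inv_orbit_map:
  fixes g :: "real^'k::finite^'k"
  assumes "det g \<noteq> 0"
  shows "matrix_inv (orbit_map g) = g ** transpose g"
proof (rule matrix_inv_unique)
  have "orbit_map g ** (g ** transpose g) = transpose (matrix_inv g) ** (matrix_inv g ** g) ** transpose g"
    by (simp add: orbit_map_def matrix_mul_assoc)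
  also have "\<dots> = transpose (g ** matrix_inv g)"
    by (simp only: matrix_inv(2)[OF assms] matrix_transpose_mul matrix_mul_rid)
  finally show "orbit_map g ** (g ** transpose g) = mat 1" by (simp add: matrix_inv[OF assms])
qed

text \<open>Because det Q = 1, a \<open>Q\<close>-orthonormal frame has determinant 1 or -1. In the
  second case one column changes sign, which preserves orthonormality.\<close>

lemma orbit_map_surj:
  fixes Q :: "real^'k::finite^'k"
  assumes Q: "Q \<in> sym_space"
  shows "\<exists>g. det g = 1 \<and> orbit_map g = Q"
proof -
  obtain P :: "real^'k^'k" where P: "transpose P ** Q ** P = mat 1"
    using exists_orthonormal_frame[of Q] sym_spaceD[OF Q] by blast
  \<comment> \<open>An arbitrary but fixed index: the column whose sign is changed.\<close>
  define i0 :: 'k where "i0 = undefined"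
  define R :: "real^'k^'k" where "R = (\<chi> i j. if i = j then if i = i0 then -1 else 1 else 0)"
  have "det R = (\<Prod>i\<in>UNIV. R $ i $ i)" by (rule det_diagonal) (simp add: R_def)
  also have "\<dots> = -1" by (simp add: R_def prod.If_cases)
  finally have R: "det R = -1" .
  have RR: "transpose R ** R = mat 1"
    by (simp add: R_def transpose_def matrix_matrix_mult_def mat_def vec_eq_iff
        if_distrib[of "(*) _"] cong: if_cong)
  have "det P * det P = 1"
    using arg_cong[OF P, of det] sym_spaceD(3)[OF Q] by (simp add: det_mul)
  then have "det P = 1 \<or> det P = -1" by (metis square_eq_1_iff)
  moreover have "transpose (P ** R) ** Q ** (P ** R) = mat 1"
  proof -
    have "transpose (P ** R) ** Q ** (P ** R) = transpose R ** (transpose P ** Q ** P) ** R"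
      by (simp add: matrix_transpose_mul matrix_mul_assoc)
    then show ?thesis by (simp add: P RR)
  qed
  moreover have "det (P ** R) = - det P" by (simp add: det_mul R)
  ultimately have "\<exists>g. det g = 1 \<and> transpose g ** Q ** g = mat 1"
    using P by (metis minus_minus)
  then obtain g where g: "det g = 1" "transpose g ** Q ** g = mat 1" by blast
  have "transpose (matrix_inv g) ** (transpose g ** Q ** g) ** matrix_inv g = Q"
    by (rule matrix_inv_congruence) (simp add: g)
  then have "orbit_map g = Q" by (simp add: g orbit_map_def)
  then show ?thesis using g by blast
qed

text \<open>The chosen \<open>g\<close> disappears through Q^-1 = g g^T and cyclicity of the trace,
  and trace-freeness of \<open>H\<close> removes the product of traces in the Killing form. The
  constant k/2 is 2k times the square of -1/2.\<close>

lemma killing_metric_eq: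
  fixes Q H K :: "real^'k::finite^'k"
  assumes Q: "Q \<in> sym_space" and H: "trace (matrix_inv Q ** H) = 0"
  shows "killing_metric Q H K = CARD('k) / 2 * trace (matrix_inv Q ** H ** matrix_inv Q ** K)"
proof -
  define g where "g = (SOME g. det g = 1 \<and> orbit_map g = Q)"
  have g: "det g = 1" "orbit_map g = Q"
    using someI_ex[OF orbit_map_surj[OF Q]] by (simp_all add: g_def)
  have inv: "matrix_inv Q = g ** transpose g"
    using matrix_inv_orbit_map[of g] g by simp
  have tr: "trace (transpose g ** H ** g) = trace (matrix_inv Q ** H)" for H
    using trace_mul_sym[of "transpose g ** H" g] by (simp add: inv matrix_mul_assoc)
  have "trace (transpose g ** H ** g ** (transpose g ** K ** g))
      = trace (g ** (transpose g ** H ** g ** transpose g ** K))"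
    using trace_mul_sym[of "transpose g ** H ** g ** transpose g ** K" g] by (simp add: matrix_mul_assoc)
  also have "\<dots> = trace (matrix_inv Q ** H ** matrix_inv Q ** K)"
    by (simp add: inv matrix_mul_assoc)
  finally show ?thesis
    unfolding killing_metric_def Let_def g_def[symmetric] killing_form_eq
    by (simp add: matrix_mult_simps trace_simps tr H)
qed

text \<open>For X = g^T H g, which is symmetric, the trace of X^2 is the squared norm of X.\<close>

lemma killing_metric_pos:
  fixes Q H :: "real^'k::finite^'k"
  assumes Q: "Q \<in> sym_space" and H: "transpose H = H" "trace (matrix_inv Q ** H) = 0" "H \<noteq> 0"
  shows "killing_metric Q H H > 0"
proof -
  obtain g where g: "det g = 1" "orbit_map g = Q" using orbit_map_surj[OF Q] by blast
  have inv: "matrix_inv Q = g ** transpose g"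
    using matrix_inv_orbit_map[of g] g by simp
  let ?X = "transpose g ** H ** g"
  have "transpose (matrix_inv g) ** ?X ** matrix_inv g = H"
    by (rule matrix_inv_congruence) (simp add: g)
  then have "?X \<noteq> 0" using H(3) by (auto simp: matrix_mult_simps)
  have "trace (matrix_inv Q ** H ** matrix_inv Q ** H) = trace (?X ** ?X)"
    using trace_mul_sym[of "transpose g ** H ** g ** transpose g ** H" g]
    by (simp add: inv matrix_mul_assoc)
  also have "\<dots> = ?X \<bullet> ?X"
    by (subst trace_transpose_mult_self[symmetric]) (simp add: matrix_transpose_mul H matrix_mul_assoc)
  finally show ?thesis using \<open>?X \<noteq> 0\<close> by (simp add: killing_metric_eq[OF Q H(2)])
qed

section \<open>Levi-Civita connections\<close>

lemma vector_derivative_smooth: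
  "smooth_on UNIV \<gamma> \<Longrightarrow> vector_derivative \<gamma> (at t) = dir_deriv \<gamma> 1 t"
  by (simp add: frechet_derivative_eq_vector_derivative smooth_on_differentiable)

lemma smooth_on_has_vector_derivative:
  "smooth_on UNIV \<gamma> \<Longrightarrow> (\<gamma> has_vector_derivative dir_deriv \<gamma> 1 t) (at t)"
  using vector_derivative_works[of \<gamma> "at t"]
  by (simp add: vector_derivative_smooth smooth_on_differentiable)

lemma smooth_on_has_real_derivative:
  "smooth_on UNIV f \<Longrightarrow> (f has_real_derivative dir_deriv f 1 t) (at t)"
  using smooth_on_has_vector_derivative by (simp add: has_real_derivative_iff_has_vector_derivative)

text \<open>\<open>smooth_curve_in\<close> asks for curves on the whole real line that never leave
  the set. Such a bounded parameter makes a local curve global without changing its velocity at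
  0.\<close>

lemma exists_bounded_curve:
  fixes \<epsilon> :: real
  assumes "\<epsilon> > 0"
  obtains \<rho> :: "real \<Rightarrow> real"
    where "smooth_on UNIV \<rho>" "\<rho> 0 = 0" "(\<rho> has_real_derivative 1) (at 0)" "\<And>t. \<bar>\<rho> t\<bar> < \<epsilon>"
proof
  \<comment> \<open>This is t / (1 + (t/\<epsilon>)^2), written with products and
    \<open>inverse\<close> so that the closure lemmas apply.\<close>
  let ?\<rho> = "\<lambda>t. t * inverse (1 + (t * inverse \<epsilon>) * (t * inverse \<epsilon>))"
  have pos: "1 + s * s > 0" for s :: real by (simp add: add_pos_nonneg)
  then have nz: "1 + s * s \<noteq> 0" for s :: real by (metis less_irrefl)
  show "smooth_on UNIV ?\<rho>"
    by (intro smooth_on_mult smooth_on_inverse smooth_on_add smooth_on_const smooth_on_ident nz) auto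
  show "?\<rho> 0 = 0" by simp
  show "(?\<rho> has_real_derivative 1) (at 0)"
    by (auto intro!: derivative_eq_intros)
  fix t
  define s where "s = t * inverse \<epsilon>"
  have t: "t = \<epsilon> * s" using assms by (simp add: s_def)
  have "\<bar>s\<bar> < 1 + s * s"
  proof (cases "\<bar>s\<bar> < 1")
    case True
    then show ?thesis using zero_le_square[of s] by linarith
  next
    case False
    then have "\<bar>s\<bar> * 1 \<le> \<bar>s\<bar> * \<bar>s\<bar>" by (intro mult_left_mono) auto
    then show ?thesis by (simp add: abs_mult_self_eq)
  qed
  then have "\<epsilon> * (\<bar>s\<bar> * inverse (1 + s * s)) < \<epsilon> * 1"
    using assms pos[of s] by (intro mult_strict_left_mono) (auto simp: field_simps)
  moreover have "\<bar>?\<rho> t\<bar> = \<epsilon> * (\<bar>s\<bar> * inverse (1 + s * s))"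
    unfolding s_def[symmetric] using t assms pos[of s] by (simp add: abs_mult)
  ultimately show "\<bar>?\<rho> t\<bar> < \<epsilon>" by simp
qed

section \<open>Uniqueness of the Levi-Civita connection\<close>

lemma levi_civita_tangent:
  "levi_civita S g \<Gamma> \<Longrightarrow> smooth_curve_in S \<gamma> \<Longrightarrow> tangent_field_along S \<gamma> V \<Longrightarrow>
    cov_deriv_along \<Gamma> \<gamma> V t \<in> tangent_space_of S (\<gamma> t)"
  unfolding levi_civita_def by blast

lemma levi_civita_metric:
  "levi_civita S g \<Gamma> \<Longrightarrow> smooth_curve_in S \<gamma> \<Longrightarrow> tangent_field_along S \<gamma> V \<Longrightarrow>
    tangent_field_along S \<gamma> W \<Longrightarrow>
    ((\<lambda>s. g (\<gamma> s) (V s) (W s)) has_real_derivative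
      g (\<gamma> t) (cov_deriv_along \<Gamma> \<gamma> V t) (W t) + g (\<gamma> t) (V t) (cov_deriv_along \<Gamma> \<gamma> W t)) (at t)"
  unfolding levi_civita_def by blast

lemma levi_civita_torsion_free:
  "levi_civita S g \<Gamma> \<Longrightarrow> q \<in> S \<Longrightarrow> u \<in> tangent_space_of S q \<Longrightarrow> v \<in> tangent_space_of S q \<Longrightarrow>
    \<Gamma> q u v = \<Gamma> q v u"
  unfolding levi_civita_def by blast

text \<open>The difference \<open>\<delta>(u, v, w) = g(\<Gamma>\<^sub>1(u, v) - \<Gamma>\<^sub>2(u, v), w)\<close> is symmetric in \<open>u, v\<close> and
  antisymmetric in \<open>v, w\<close>, hence zero.\<close>

lemma levi_civita_unique:
  fixes g :: "'a::real_normed_vector \<Rightarrow> 'a \<Rightarrow> 'a \<Rightarrow> real"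
  assumes LC: "levi_civita S g \<Gamma>\<^sub>1" "levi_civita S g \<Gamma>\<^sub>2" and q: "q \<in> S"
    and sub: "subspace (tangent_space_of S q)"
    and diff: "\<And>u v w. u \<in> tangent_space_of S q \<Longrightarrow> v \<in> tangent_space_of S q \<Longrightarrow>
      w \<in> tangent_space_of S q \<Longrightarrow> g q (u - v) w = g q u w - g q v w"
    and sym: "\<And>u v. u \<in> tangent_space_of S q \<Longrightarrow> v \<in> tangent_space_of S q \<Longrightarrow> g q u v = g q v u"
    and pos: "\<And>u. u \<in> tangent_space_of S q \<Longrightarrow> u \<noteq> 0 \<Longrightarrow> g q u u > 0"
    and ext: "\<And>\<gamma> v. smooth_curve_in S \<gamma> \<Longrightarrow> v \<in> tangent_space_of S (\<gamma> 0) \<Longrightarrow>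
      \<exists>V. tangent_field_along S \<gamma> V \<and> V 0 = v"
    and u: "u \<in> tangent_space_of S q" and v: "v \<in> tangent_space_of S q"
  shows "\<Gamma>\<^sub>1 q u v = \<Gamma>\<^sub>2 q u v"
proof -
  let ?T = "tangent_space_of S q"
  define D where "D u v = \<Gamma>\<^sub>1 q u v - \<Gamma>\<^sub>2 q u v" for u v
  define d where "d u v w = g q (D u v) w" for u v w
  have *: "D u v \<in> ?T \<and> d u v w + d u w v = 0" if T: "u \<in> ?T" "v \<in> ?T" "w \<in> ?T" for u v w
  proof -
    obtain \<gamma> where \<gamma>: "smooth_curve_in S \<gamma>" "\<gamma> 0 = q" "vector_derivative \<gamma> (at 0) = u"
      using T(1) by (auto simp: tangent_space_of_def)
    obtain V W where V: "tangent_field_along S \<gamma> V" "V 0 = v" and W: "tangent_field_along S \<gamma> W" "W 0 = w"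
      using ext[OF \<gamma>(1)] T \<gamma>(2) by metis
    let ?c = "\<lambda>\<Gamma> V. cov_deriv_along \<Gamma> \<gamma> V 0"
    have c: "?c \<Gamma> V \<in> ?T" "?c \<Gamma> W \<in> ?T"
      "((\<lambda>s. g (\<gamma> s) (V s) (W s)) has_real_derivative g q (?c \<Gamma> V) w + g q v (?c \<Gamma> W)) (at 0)"
      if "levi_civita S g \<Gamma>" for \<Gamma>
      using levi_civita_tangent[OF that \<gamma>(1) V(1), of 0] levi_civita_tangent[OF that \<gamma>(1) W(1), of 0]
        levi_civita_metric[OF that \<gamma>(1) V(1) W(1), of 0] by (simp_all add: \<gamma> V W)
    \<comment> \<open>Both connections are compatible with \<open>g\<close>, so both sides are the
      derivative of the same function.\<close>
    have "g q (?c \<Gamma>\<^sub>1 V) w + g q v (?c \<Gamma>\<^sub>1 W) = g q (?c \<Gamma>\<^sub>2 V) w + g q v (?c \<Gamma>\<^sub>2 W)"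
      using c(3)[OF LC(1)] c(3)[OF LC(2)] by (rule DERIV_unique)
    \<comment> \<open>The ordinary derivatives of \<open>V\<close> and \<open>W\<close> cancel,
      which makes the difference tensorial.\<close>
    moreover have D: "?c \<Gamma>\<^sub>1 V - ?c \<Gamma>\<^sub>2 V = D u v" "?c \<Gamma>\<^sub>1 W - ?c \<Gamma>\<^sub>2 W = D u w"
      by (simp_all add: cov_deriv_along_def D_def \<gamma> V W)
    moreover have "g q (?c \<Gamma>\<^sub>1 V - ?c \<Gamma>\<^sub>2 V) w = g q (?c \<Gamma>\<^sub>1 V) w - g q (?c \<Gamma>\<^sub>2 V) w"
      "g q (?c \<Gamma>\<^sub>1 W - ?c \<Gamma>\<^sub>2 W) v = g q (?c \<Gamma>\<^sub>1 W) v - g q (?c \<Gamma>\<^sub>2 W) v"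
      using c LC T by (auto intro!: diff)
    moreover have "g q v (?c \<Gamma>\<^sub>1 W) = g q (?c \<Gamma>\<^sub>1 W) v" "g q v (?c \<Gamma>\<^sub>2 W) = g q (?c \<Gamma>\<^sub>2 W) v"
      using c LC T by (auto intro!: sym)
    ultimately have "d u v w + d u w v = 0" by (simp add: d_def)
    moreover have "D u v \<in> ?T"
      unfolding D[symmetric] by (intro subspace_diff sub c LC)
    ultimately show ?thesis by blast
  qed
  have D_sym: "D u v = D v u" if "u \<in> ?T" "v \<in> ?T" for u v
    unfolding D_def using levi_civita_torsion_free[OF LC(1) q that]
      levi_civita_torsion_free[OF LC(2) q that] by simp
  have "d u v w = 0" if w: "w \<in> ?T" for w
  proof -
    \<comment> \<open>Antisymmetry and symmetry alternate three times each; the total sign is -1 and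
      the arguments return to their places.\<close>
    have "d u v w = - d u w v" using *[OF u v w] by simp
    also have "d u w v = d w u v" by (simp add: d_def D_sym u w)
    also have "d w u v = - d w v u" using *[OF w u v] by simp
    also have "d w v u = d v w u" by (simp add: d_def D_sym v w)
    also have "d v w u = - d v u w" using *[OF v w u] by simp
    also have "d v u w = d u v w" by (simp add: d_def D_sym u v)
    finally show ?thesis by simp
  qed
  moreover have "D u v \<in> ?T" using * u v by blast
  ultimately have "D u v = 0" using pos[of "D u v"] by (force simp: d_def)
  then show ?thesis by (simp add: D_def)
qed

text \<open>\<open>christoffel\<close> is an arbitrary choice. Its value is known where all
  candidates agree, provided that a candidate exists.\<close>

lemma christoffel_eq:
  assumes "levi_civita S g \<Gamma>"
    and "\<And>\<Gamma>'. levi_civita S g \<Gamma>' \<Longrightarrow> \<Gamma>' q u v = \<Gamma> q u v"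
  shows "christoffel S g q u v = \<Gamma> q u v"
  unfolding christoffel_def using assms(2)[OF someI[of "levi_civita S g", OF assms(1)]] .

subsection \<open>Open subsets of Euclidean space\<close>

text \<open>Every vector is the velocity of a straight line, which the bounded parameter keeps
  inside a ball in \<open>U\<close>.\<close>

lemma tangent_space_of_open:
  fixes U :: "'a::real_normed_vector set"
  assumes "open U" "q \<in> U"
  shows "tangent_space_of U q = UNIV"
proof -
  have "v \<in> tangent_space_of U q" for v
  proof -
    obtain r where r: "r > 0" "ball q r \<subseteq> U" using assms open_contains_ball by blast
    then have "r / (norm v + 1) > 0" by (simp add: add_nonneg_pos)
    then obtain \<rho> where \<rho>: "smooth_on UNIV \<rho>" "\<rho> 0 = 0" "(\<rho> has_real_derivative 1) (at 0)"
      "\<And>t. \<bar>\<rho> t\<bar> < r / (norm v + 1)"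
      using exists_bounded_curve by metis
    let ?\<gamma> = "\<lambda>t. q + \<rho> t *\<^sub>R v"
    have sm: "smooth_on UNIV ?\<gamma>"
      by (intro smooth_on_add smooth_on_const smooth_on_bilinear[OF bounded_bilinear_scaleR] \<rho>) auto
    have "?\<gamma> t \<in> U" for t
    proof -
      have "norm v + 1 > 0" by (simp add: add_nonneg_pos)
      then have "\<bar>\<rho> t\<bar> * (norm v + 1) < r" using \<rho>(4)[of t] by (simp add: field_simps)
      moreover have "\<bar>\<rho> t\<bar> * norm v \<le> \<bar>\<rho> t\<bar> * (norm v + 1)" by (intro mult_left_mono) auto
      ultimately have "dist q (?\<gamma> t) < r" by (simp add: dist_norm)
      then show ?thesis using r by auto
    qed
    moreover have "vector_derivative ?\<gamma> (at 0) = v"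
      using \<rho>(3) by (intro vector_derivative_at)
        (auto intro!: derivative_eq_intros simp: has_real_derivative_iff_has_vector_derivative)
    ultimately show ?thesis
      using sm \<rho>(2) unfolding tangent_space_of_def smooth_curve_in_def by (auto intro!: exI[of _ ?\<gamma>])
  qed
  then show ?thesis by auto
qed

text \<open>The Koszul formula for constant coordinate fields, whose brackets vanish. The last
  vector collects the components of the covector w -> (D_w G)(u, v), and \<open>matrix_inv\<close>
  raises the index.\<close>

definition metric_christoffel :: "(real^'n::finite \<Rightarrow> real^'n^'n) \<Rightarrow> real^'n \<Rightarrow> real^'n \<Rightarrow> real^'n \<Rightarrow> real^'n"
  where "metric_christoffel G x u v = matrix_inv (G x) *v ((1/2) *\<^sub>R
    (dir_deriv G u x *v v + dir_deriv G v x *v u - (\<chi> l. scalar_prod (dir_deriv G (axis l 1) x) u v)))"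

lemma metric_christoffel_koszul:
  fixes G :: "real^'n::finite \<Rightarrow> real^'n^'n"
  assumes "smooth_on U G" "x \<in> U" and G: "transpose (G x) = G x" "det (G x) \<noteq> 0"
  shows "scalar_prod (G x) (metric_christoffel G x u v) w =
    (w \<bullet> (dir_deriv G u x *v v) + w \<bullet> (dir_deriv G v x *v u) - scalar_prod (dir_deriv G w x) u v) / 2"
proof -
  let ?c = "(1/2) *\<^sub>R
    (dir_deriv G u x *v v + dir_deriv G v x *v u - (\<chi> l. scalar_prod (dir_deriv G (axis l 1) x) u v))"
  have lin: "linear (\<lambda>w. scalar_prod (dir_deriv G w x) u v)"
    using smooth_on_linear_derivative[OF assms(1,2)]
    by (auto simp: linear_iff scalar_prod_def matrix_vector_mult_simps inner_simps)
  have "scalar_prod (dir_deriv G w x) u v = scalar_prod (dir_deriv G (\<Sum>l\<in>UNIV. w $ l *\<^sub>R axis l 1) x) u v"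
    using basis_expansion[of w] by (simp add: scalar_mult_eq_scaleR)
  also have "\<dots> = w \<bullet> (\<chi> l. scalar_prod (dir_deriv G (axis l 1) x) u v)"
    by (simp add: linear_sum[OF lin] linear_cmul[OF lin] inner_vec_def)
  finally have 1: "w \<bullet> (\<chi> l. scalar_prod (dir_deriv G (axis l 1) x) u v) = scalar_prod (dir_deriv G w x) u v"
    by simp
  have "scalar_prod (G x) (metric_christoffel G x u v) w = w \<bullet> (G x *v (matrix_inv (G x) *v ?c))"
    by (subst scalar_prod_commute[OF G(1)]) (simp only: scalar_prod_def metric_christoffel_def)
  then show ?thesis
    by (simp only: matrix_inv_vector(2)[OF G(2)] inner_simps 1)
qed

lemma transpose_dir_deriv:
  fixes G :: "'a::real_normed_vector \<Rightarrow> real^'k::finite^'k"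
  assumes U: "open U" "x \<in> U" and G: "smooth_on U G" "\<And>x. x \<in> U \<Longrightarrow> transpose (G x) = G x"
  shows "transpose (dir_deriv G v x) = dir_deriv G v x"
  using dir_deriv_linear[OF bounded_linear_transpose G(1) U(2), of v]
    frechet_derivative_cong_open[OF U, of "\<lambda>x. transpose (G x)" G] G(2) by simp

locale metric_on =
  fixes U :: "(real^'n::finite) set" and h :: "real^'n \<Rightarrow> real^'n \<Rightarrow> real^'n \<Rightarrow> real"
    and G :: "real^'n \<Rightarrow> real^'n^'n"
  assumes U: "open U" and G: "smooth_on U G"
    and h: "\<And>x. x \<in> U \<Longrightarrow> h x = scalar_prod (G x)"
    and G_sym: "\<And>x. x \<in> U \<Longrightarrow> transpose (G x) = G x"
    and G_pos: "\<And>x v. x \<in> U \<Longrightarrow> v \<noteq> 0 \<Longrightarrow> scalar_prod (G x) v v > 0"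
begin

lemma det_G: "x \<in> U \<Longrightarrow> det (G x) \<noteq> 0"
proof
  assume "x \<in> U" "det (G x) = 0"
  then obtain v where "v \<noteq> 0" "G x *v v = 0"
    using matrix_nonfull_linear_equations_eq[of "G x"] det_eq_0_rank[of "G x"]
    by (metis less_irrefl)
  then show False using G_pos[OF \<open>x \<in> U\<close>, of v] by (simp add: scalar_prod_def)
qed

lemma koszul:
  assumes x: "x \<in> U"
  shows "scalar_prod (G x) (metric_christoffel G x u v) w =
    (scalar_prod (dir_deriv G u x) v w + scalar_prod (dir_deriv G v x) u w
      - scalar_prod (dir_deriv G w x) u v) / 2"
proof -
  have "a \<bullet> (dir_deriv G b x *v c) = scalar_prod (dir_deriv G b x) c a" for a b c
    using scalar_prod_commute[OF transpose_dir_deriv[OF U x G G_sym], of b c a]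
    by (simp add: scalar_prod_def)
  then show ?thesis
    by (simp add: metric_christoffel_koszul[OF G x G_sym[OF x] det_G[OF x]])
qed

text \<open>In the sum of the Koszul expressions for Q(L(u, v), w) and Q(L(u, w), v), with Q =
  \<open>G x\<close>, only (D_u G)(v, w) survives; this is compatibility with the metric. Tangency
  holds because every vector is tangent to an open set.\<close>

lemma levi_civita_metric_christoffel: "levi_civita U h (metric_christoffel G)"
  unfolding levi_civita_def
proof (intro conjI ballI allI impI)
  fix x assume x: "x \<in> U"
  note lin = smooth_on_linear_derivative[OF G x]
  define c where "c u v = dir_deriv G u x *v v + dir_deriv G v x *v u -
    (\<chi> l. scalar_prod (dir_deriv G (axis l 1) x) u v)" for u v
  have "c (a + b) v = c a v + c b v" "c v (a + b) = c v a + c v b"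
    "c (r *\<^sub>R a) v = r *\<^sub>R c a v" "c v (r *\<^sub>R a) = r *\<^sub>R c v a" for a b v r
    by (simp_all add: c_def linear_add[OF lin] linear_cmul[OF lin] matrix_vector_mult_simps
        scalar_prod_simps vec_eq_iff right_diff_distrib distrib_left)
  then show "bilinear (metric_christoffel G x)"
    unfolding bilinear_def linear_iff metric_christoffel_def c_def[symmetric]
    by (simp add: matrix_vector_mult_simps scaleR_add_right)
  fix u v
  have "scalar_prod (dir_deriv G a x) u v = scalar_prod (dir_deriv G a x) v u" for a
    by (rule scalar_prod_commute[OF transpose_dir_deriv[OF U x G G_sym]])
  then show "metric_christoffel G x u v = metric_christoffel G x v u"
    by (simp add: metric_christoffel_def add.commute)
next
  fix \<gamma> :: "real \<Rightarrow> real^'n" and V t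
  assume "smooth_curve_in U \<gamma>"
  then show "cov_deriv_along (metric_christoffel G) \<gamma> V t \<in> tangent_space_of U (\<gamma> t)"
    using tangent_space_of_open[OF U, of "\<gamma> t"] by (auto simp: smooth_curve_in_def)
next
  fix \<gamma> :: "real \<Rightarrow> real^'n" and V W t
  assume \<gamma>: "smooth_curve_in U \<gamma>" and V: "tangent_field_along U \<gamma> V" and W: "tangent_field_along U \<gamma> W"
  let ?\<gamma>' = "vector_derivative \<gamma> (at t)"
  let ?V' = "vector_derivative V (at t)" and ?W' = "vector_derivative W (at t)"
  have inU: "\<gamma> s \<in> U" for s using \<gamma> by (auto simp: smooth_curve_in_def)
  note lin = smooth_on_linear_derivative[OF G inU]
  have vd: "(X has_derivative (\<lambda>r. r *\<^sub>R vector_derivative X (at t))) (at t)"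
    if "smooth_on UNIV X" for X :: "real \<Rightarrow> real^'n"
    using smooth_on_has_vector_derivative[OF that, of t]
    by (simp add: vector_derivative_smooth[OF that] has_vector_derivative_def)
  have sm: "smooth_on UNIV \<gamma>" "smooth_on UNIV V" "smooth_on UNIV W"
    using \<gamma> V W by (auto simp: smooth_curve_in_def tangent_field_along_def)
  have "((\<lambda>s. G (\<gamma> s)) has_derivative (\<lambda>r. r *\<^sub>R dir_deriv G ?\<gamma>' (\<gamma> t))) (at t)"
    using diff_chain_at[OF vd[OF sm(1)] smooth_on_has_derivative[OF G inU]]
    by (simp add: o_def linear_cmul[OF lin])
  then have "((\<lambda>s. V s \<bullet> (G (\<gamma> s) *v W s)) has_derivative
      (\<lambda>r. V t \<bullet> (G (\<gamma> t) *v (r *\<^sub>R ?W') + (r *\<^sub>R dir_deriv G ?\<gamma>' (\<gamma> t)) *v W t)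
        + (r *\<^sub>R ?V') \<bullet> (G (\<gamma> t) *v W t))) (at t)"
    by (intro has_derivative_inner bounded_bilinear.FDERIV[OF bounded_bilinear_matrix_vector_mult]
        vd sm)
  then have "((\<lambda>s. scalar_prod (G (\<gamma> s)) (V s) (W s)) has_real_derivative
      scalar_prod (G (\<gamma> t)) (V t) ?W' + scalar_prod (dir_deriv G ?\<gamma>' (\<gamma> t)) (V t) (W t)
        + scalar_prod (G (\<gamma> t)) ?V' (W t)) (at t)"
    unfolding has_field_derivative_def scalar_prod_def
    by (rule has_derivative_eq_rhs)
      (simp add: fun_eq_iff matrix_vector_mult_simps inner_simps algebra_simps)
  moreover have "scalar_prod (G (\<gamma> t)) (V t) ?W' + scalar_prod (dir_deriv G ?\<gamma>' (\<gamma> t)) (V t) (W t)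
        + scalar_prod (G (\<gamma> t)) ?V' (W t)
    = scalar_prod (G (\<gamma> t)) (cov_deriv_along (metric_christoffel G) \<gamma> V t) (W t)
      + scalar_prod (G (\<gamma> t)) (V t) (cov_deriv_along (metric_christoffel G) \<gamma> W t)"
  proof -
    have "scalar_prod (G (\<gamma> t)) (V t) (cov_deriv_along (metric_christoffel G) \<gamma> W t)
      = scalar_prod (G (\<gamma> t)) (V t) ?W' + scalar_prod (G (\<gamma> t)) (metric_christoffel G (\<gamma> t) ?\<gamma>' (W t)) (V t)"
      using scalar_prod_commute[OF G_sym[OF inU], of t "V t"]
      by (simp add: cov_deriv_along_def scalar_prod_simps)
    moreover have "scalar_prod (dir_deriv G ?\<gamma>' (\<gamma> t)) (W t) (V t)
        = scalar_prod (dir_deriv G ?\<gamma>' (\<gamma> t)) (V t) (W t)"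
      by (rule scalar_prod_commute[OF transpose_dir_deriv[OF U inU G G_sym]])
    ultimately show ?thesis
      by (simp add: cov_deriv_along_def scalar_prod_simps koszul[OF inU])
        (simp add: field_simps)
  qed
  ultimately show "((\<lambda>s. h (\<gamma> s) (V s) (W s)) has_real_derivative
      h (\<gamma> t) (cov_deriv_along (metric_christoffel G) \<gamma> V t) (W t)
      + h (\<gamma> t) (V t) (cov_deriv_along (metric_christoffel G) \<gamma> W t)) (at t)"
    by (simp add: h inU)
qed

lemma christoffel_eq_metric_christoffel:
  assumes x: "x \<in> U"
  shows "christoffel U h x u v = metric_christoffel G x u v"
proof (rule christoffel_eq[OF levi_civita_metric_christoffel])
  fix \<Gamma>' assume \<Gamma>': "levi_civita U h \<Gamma>'"
  show "\<Gamma>' x u v = metric_christoffel G x u v"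
  proof (rule levi_civita_unique[OF \<Gamma>' levi_civita_metric_christoffel x])
    fix \<gamma> :: "real \<Rightarrow> real^'n" and v
    assume "smooth_curve_in U \<gamma>"
    \<comment> \<open>A constant field extends the vector along the curve, as all its values are
      tangent.\<close>
    then show "\<exists>V. tangent_field_along U \<gamma> V \<and> V 0 = v"
      by (intro exI[of _ "\<lambda>_. v"])
        (auto simp: tangent_field_along_def smooth_curve_in_def tangent_space_of_open[OF U] image_subset_iff)
  qed (use x in \<open>auto simp: tangent_space_of_open[OF U] h scalar_prod_simps G_pos
      intro: scalar_prod_commute G_sym\<close>)
qed

end

subsection \<open>The space \<open>SL/SO\<close>\<close>

text \<open>Differentiate Q^T = Q and det Q = 1 along a curve; Jacobi's formula turns the second
  into the trace condition.\<close>

lemma tangent_space_of_sym_spaceD: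
  fixes Q H :: "real^'k::finite^'k"
  assumes H: "H \<in> tangent_space_of sym_space Q"
  shows "transpose H = H" "trace (matrix_inv Q ** H) = 0"
proof -
  obtain \<gamma> where \<gamma>: "smooth_on UNIV \<gamma>" "\<And>t. \<gamma> t \<in> sym_space" "\<gamma> 0 = Q" "vector_derivative \<gamma> (at 0) = H"
    using H by (auto simp: tangent_space_of_def smooth_curve_in_def)
  then have H: "dir_deriv \<gamma> 1 0 = H" by (simp add: vector_derivative_smooth)
  show "transpose H = H"
    using transpose_dir_deriv[of UNIV 0 \<gamma> 1] \<gamma> H by (simp add: sym_spaceD)
  have "((\<lambda>t. det (\<gamma> t)) has_derivative (\<lambda>v. det (\<gamma> 0) * trace (matrix_inv (\<gamma> 0) ** dir_deriv \<gamma> v 0))) (at 0)"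
    by (rule has_derivative_det[OF smooth_on_has_derivative[OF \<gamma>(1)]]) (simp_all add: sym_spaceD \<gamma>(2))
  then have "((\<lambda>t::real. 1) has_derivative (\<lambda>v. trace (matrix_inv Q ** dir_deriv \<gamma> v 0))) (at 0)"
    using sym_spaceD(3)[OF \<gamma>(2)[of 0]] sym_spaceD(3)[OF \<gamma>(2)] \<gamma>(3) by simp
  then have "(\<lambda>v. trace (matrix_inv Q ** dir_deriv \<gamma> v 0)) = (\<lambda>v. 0)"
    using has_derivative_const by (rule has_derivative_unique)
  then show "trace (matrix_inv Q ** H) = 0" using H by metis
qed

lemma congruence_sym_space:
  fixes Q B :: "real^'k::finite^'k"
  assumes Q: "Q \<in> sym_space" and B: "\<bar>det B\<bar> = 1"
  shows "transpose B ** Q ** B \<in> sym_space"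
proof -
  have nz: "det B \<noteq> 0" using B by auto
  have "det B * det B = 1" using B by (metis abs_mult_self_eq mult_1)
  moreover have "scalar_prod (transpose B ** Q ** B) v v > 0" if "v \<noteq> 0" for v
  proof -
    have "B *v v \<noteq> 0" using matrix_inv_vector(1)[OF nz, of v] that by force
    then show ?thesis using sym_spaceD(2)[OF Q] by (simp add: scalar_prod_transform[symmetric])
  qed
  ultimately show ?thesis
    unfolding sym_space_def by (simp add: matrix_transpose_mul matrix_mul_assoc det_mul sym_spaceD[OF Q])
qed

lemma det_scaleR: "det (r *\<^sub>R A) = r ^ CARD('k) * det (A :: real^'k::finite^'k)"
proof -
  have "r *\<^sub>R A = (\<chi> i. r *s A $ i)" by (simp add: vec_eq_iff)
  then show ?thesis using det_rows_mul[of "\<lambda>_. r" "\<lambda>i. A $ i"] by (simp add: vec_lambda_eta)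
qed

text \<open>The curve is \<open>B(t)\<^sup>T Q B(t)\<close>, where \<open>B(t)\<close> is \<open>1 + \<rho>(t) Q\<^sup>-\<^sup>1 H / 2\<close> scaled to determinant 1.\<close>

lemma tangent_space_of_sym_spaceI:
  fixes Q H :: "real^'k::finite^'k"
  assumes Q: "Q \<in> sym_space" and H: "transpose H = H" "trace (matrix_inv Q ** H) = 0"
  shows "H \<in> tangent_space_of sym_space Q"
proof -
  \<comment> \<open>The factor 1/2 makes X^T Q + Q X = H, since B(t) acts on both sides of
    \<open>Q\<close>.\<close>
  define X where "X = (1/2) *\<^sub>R (matrix_inv Q ** H)"
  have trX: "trace X = 0" by (simp add: X_def trace_simps H)
  have "isCont (\<lambda>r. det (mat 1 + r *\<^sub>R X)) 0"
    using smooth_on_continuous[OF smooth_on_det[of UNIV "\<lambda>r. mat 1 + r *\<^sub>R X"]]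
    by (force intro!: smooth_on_add smooth_on_const smooth_on_bilinear[OF bounded_bilinear_scaleR]
        smooth_on_ident simp: continuous_on_eq_continuous_at)
  \<comment> \<open>The bound on r keeps the determinant positive along the whole curve, as the real
    power requires.\<close>
  then obtain \<epsilon> where \<epsilon>: "\<epsilon> > 0" "\<And>r. \<bar>r\<bar> < \<epsilon> \<Longrightarrow> \<bar>det (mat 1 + r *\<^sub>R X) - 1\<bar> < 1"
    unfolding continuous_at_eps_delta dist_norm real_norm_def by (auto dest: spec[of _ 1])
  obtain \<rho> where \<rho>: "smooth_on UNIV \<rho>" "\<rho> 0 = 0" "(\<rho> has_real_derivative 1) (at 0)" "\<And>t. \<bar>\<rho> t\<bar> < \<epsilon>"
    using exists_bounded_curve[OF \<epsilon>(1)] by blast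
  define A where "A t = mat 1 + \<rho> t *\<^sub>R X" for t
  \<comment> \<open>Scaling a k by k matrix by s multiplies its determinant by s^k, so s =
    det(A)^(-1/k) normalizes it.\<close>
  define a where "a = - 1 / real CARD('k)"
  define B where "B t = det (A t) powr a *\<^sub>R A t" for t
  have det_A: "det (A t) > 0" for t using \<epsilon>(2)[OF \<rho>(4)[of t]] by (simp add: A_def abs_if split: if_splits)
  have sm_A: "smooth_on UNIV A"
    unfolding A_def by (intro smooth_on_add smooth_on_const smooth_on_bilinear[OF bounded_bilinear_scaleR] \<rho>) auto
  have sm_s: "smooth_on UNIV (\<lambda>t. det (A t) powr a)"
    by (intro smooth_on_powr smooth_on_det sm_A det_A) auto
  have sm_B: "smooth_on UNIV B"
    unfolding B_def by (intro smooth_on_bilinear[OF bounded_bilinear_scaleR] sm_A sm_s) auto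
  have "(\<rho> has_derivative (\<lambda>v. v)) (at 0)"
    by (rule has_derivative_eq_rhs[OF \<rho>(3)[unfolded has_field_derivative_def]]) (simp add: fun_eq_iff)
  then have dA: "(A has_derivative (\<lambda>v. v *\<^sub>R X)) (at 0)"
    unfolding A_def by (auto intro!: derivative_eq_intros)
  have A0: "A 0 = mat 1" by (simp add: A_def \<rho>)
  \<comment> \<open>As \<open>X\<close> is trace-free, the scaling factor is stationary at 0 and
    leaves the velocity \<open>X\<close> unchanged.\<close>
  have "((\<lambda>t. det (A t)) has_derivative (\<lambda>v. 0)) (at 0)"
    using has_derivative_det[OF dA]
    by (simp add: A0 matrix_mult_simps trace_simps trX matrix_inv_unique[of "mat 1" "mat 1"])
  then have "((\<lambda>t. det (A t)) has_real_derivative 0) (at 0)"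
    unfolding has_field_derivative_def by (rule has_derivative_eq_rhs) (simp add: fun_eq_iff)
  then have "((\<lambda>t. det (A t) powr a) has_real_derivative 0) (at 0)"
    using DERIV_chain2[of "\<lambda>z. z powr a" _ "\<lambda>t. det (A t)",
        OF has_real_derivative_powr[OF det_A[of 0], of a]] by fastforce
  then have "((\<lambda>t. det (A t) powr a) has_derivative (\<lambda>v. 0)) (at 0)"
    unfolding has_field_derivative_def by (rule has_derivative_eq_rhs) (simp add: fun_eq_iff)
  from has_derivative_scaleR[OF this dA]
  have dB: "(B has_derivative (\<lambda>v. v *\<^sub>R X)) (at 0)"
    by (simp add: B_def[abs_def] A0)
  have B0: "B 0 = mat 1" by (simp add: B_def A0)
  have det_B: "det (B t) = 1" for t
  proof -
    have "det (B t) = (det (A t) powr a) ^ CARD('k) * det (A t)"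
      by (simp add: B_def det_scaleR)
    also have "(det (A t) powr a) ^ CARD('k) = det (A t) powr (-1)"
      using det_A[of t] by (simp add: powr_realpow[symmetric] powr_powr a_def)
    also have "det (A t) powr (-1) * det (A t) = 1"
      using det_A[of t] by (simp add: powr_minus_divide)
    finally show ?thesis .
  qed
  let ?\<gamma> = "\<lambda>t. transpose (B t) ** Q ** B t"
  have "smooth_on UNIV ?\<gamma>"
    by (intro smooth_on_bilinear[OF bounded_bilinear_matrix_mult] smooth_on_linear[OF bounded_linear_transpose]
        smooth_on_const sm_B) auto
  moreover have "?\<gamma> t \<in> sym_space" for t
    by (rule congruence_sym_space[OF Q]) (simp add: det_B)
  moreover have "?\<gamma> 0 = Q" by (simp add: B0)
  moreover have "vector_derivative ?\<gamma> (at 0) = H"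
  proof (rule vector_derivative_at)
    have "Q ** X = (1/2) *\<^sub>R H"
      by (simp add: X_def matrix_mult_simps matrix_mul_assoc matrix_inv sym_spaceD[OF Q])
    moreover have "transpose X ** Q = (1/2) *\<^sub>R H"
      by (simp add: X_def matrix_mult_simps transpose_simps matrix_transpose_mul H
          transpose_matrix_inv_sym_space[OF Q])
        (simp add: matrix_mul_assoc[symmetric] matrix_inv sym_spaceD[OF Q])
    ultimately show "(?\<gamma> has_vector_derivative H) (at 0)"
      unfolding has_vector_derivative_def
      by (intro has_derivative_eq_rhs[OF bounded_bilinear.FDERIV[OF bounded_bilinear_matrix_mult
            bounded_bilinear.FDERIV[OF bounded_bilinear_matrix_mult
              bounded_linear.has_derivative[OF bounded_linear_transpose dB] has_derivative_const] dB]])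
        (simp add: fun_eq_iff B0 matrix_mult_simps transpose_simps flip: scaleR_add_left)
  qed
  ultimately show ?thesis
    unfolding tangent_space_of_def smooth_curve_in_def by (auto intro!: exI[of _ ?\<gamma>])
qed

lemma tangent_space_of_sym_space:
  "Q \<in> sym_space \<Longrightarrow>
    tangent_space_of sym_space Q = {H. transpose H = H \<and> trace (matrix_inv Q ** H) = 0}"
  using tangent_space_of_sym_spaceD tangent_space_of_sym_spaceI by blast

text \<open>Along a curve with velocity N the derivative of Q^-1 V is Q^-1 (V' - N Q^-1 V).
  Averaging the correction N Q^-1 V with its transpose keeps the covariant derivative symmetric and
  the connection torsion-free.\<close>

definition sym_space_christoffel :: "real^'k^'k \<Rightarrow> real^'k^'k \<Rightarrow> real^'k^'k \<Rightarrow> real^'k::finite^'k" where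
  "sym_space_christoffel Q H K = (- 1/2) *\<^sub>R (H ** matrix_inv Q ** K + K ** matrix_inv Q ** H)"

text \<open>Tangency follows from the derivatives of the symmetry and trace conditions on the field.
  For compatibility, differentiate tr(Q^-1 V Q^-1 W) and match the terms by cyclicity of the trace;
  the constant k/2 factors out.\<close>

lemma levi_civita_sym_space_christoffel:
  "levi_civita sym_space killing_metric (sym_space_christoffel :: _ \<Rightarrow> _ \<Rightarrow> _ \<Rightarrow> real^'k::finite^'k)"
  unfolding levi_civita_def
proof (intro conjI ballI allI impI)
  fix Q :: "real^'k^'k"
  show "bilinear (sym_space_christoffel Q)"
    unfolding bilinear_def linear_iff
    by (simp add: sym_space_christoffel_def matrix_mult_simps algebra_simps)
  show "sym_space_christoffel Q u v = sym_space_christoffel Q v u" for u v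
    by (simp add: sym_space_christoffel_def add.commute)
next
  fix \<gamma> :: "real \<Rightarrow> real^'k^'k"
  assume \<gamma>: "smooth_curve_in sym_space \<gamma>"
  then have sm: "smooth_on UNIV \<gamma>" and inS: "\<And>t. \<gamma> t \<in> sym_space"
    by (auto simp: smooth_curve_in_def)
  define M where "M t = matrix_inv (\<gamma> t)" for t
  have sm_M: "smooth_on UNIV M"
    unfolding M_def by (intro smooth_on_matrix_inv sm) (simp_all add: sym_spaceD[OF inS])
  define N where "N t = dir_deriv \<gamma> 1 t" for t
  have dM: "dir_deriv M 1 t = - (M t ** N t ** M t)" for t
    unfolding M_def[abs_def] N_def by (rule dir_deriv_matrix_inv[of UNIV]) (simp_all add: sm sym_spaceD[OF inS])
  have NT: "transpose (N t) = N t" for t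
    unfolding N_def by (rule transpose_dir_deriv[of UNIV]) (simp_all add: sm sym_spaceD[OF inS])
  have MT: "transpose (M t) = M t" for t
    unfolding M_def by (rule transpose_matrix_inv_sym_space[OF inS])
  have field: "smooth_on UNIV V \<and> transpose (V t) = V t \<and> trace (M t ** V t) = 0"
    if "tangent_field_along sym_space \<gamma> V" for V t
    using that inS by (auto simp: tangent_field_along_def tangent_space_of_sym_space M_def)
  have cov: "cov_deriv_along sym_space_christoffel \<gamma> V t =
      dir_deriv V 1 t - (1/2) *\<^sub>R (N t ** M t ** V t + V t ** M t ** N t)"
    if "smooth_on UNIV V" for V t
    by (simp add: cov_deriv_along_def vector_derivative_smooth[OF sm] vector_derivative_smooth[OF that]
        sym_space_christoffel_def M_def N_def)
  have dMV: "dir_deriv (\<lambda>s. M s ** V s) 1 t = M t ** dir_deriv V 1 t - M t ** N t ** M t ** V t"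
    if "smooth_on UNIV V" for V :: "real \<Rightarrow> real^'k^'k" and t
    by (simp add: dir_deriv_bilinear[OF bounded_bilinear_matrix_mult sm_M that UNIV_I] dM
        matrix_mult_simps)
  have sm_MV: "smooth_on UNIV (\<lambda>s. M s ** V s)" if "smooth_on UNIV V" for V :: "real \<Rightarrow> real^'k^'k"
    by (intro smooth_on_bilinear[OF bounded_bilinear_matrix_mult] sm_M that) auto
  have tr: "trace (M t ** V t ** M t ** N t) = trace (M t ** N t ** M t ** V t)" for V t
    using trace_mul_sym[of "M t ** V t" "M t ** N t"] by (simp add: matrix_mul_assoc)
  {
    fix V t assume V: "tangent_field_along sym_space \<gamma> V"
    have smV: "smooth_on UNIV V" using field[OF V] by blast
    have "trace (dir_deriv (\<lambda>s. M s ** V s) 1 t) = 0"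
      using dir_deriv_linear[OF bounded_linear_trace sm_MV[OF smV] UNIV_I, where v = 1 and x = t] field[OF V] by simp
    then have 1: "trace (M t ** dir_deriv V 1 t) = trace (M t ** N t ** M t ** V t)"
      by (simp add: dMV[OF smV] trace_simps)
    have 2: "transpose (dir_deriv V 1 t) = dir_deriv V 1 t"
      by (rule transpose_dir_deriv[of UNIV]) (use field[OF V] in auto)
    have "trace (M t ** cov_deriv_along sym_space_christoffel \<gamma> V t) = 0"
      by (simp add: cov[OF smV] matrix_mult_simps trace_simps 1 matrix_mul_assoc tr)
    moreover have "transpose (cov_deriv_along sym_space_christoffel \<gamma> V t)
        = cov_deriv_along sym_space_christoffel \<gamma> V t"
      using field[OF V, of t]
      by (simp add: cov[OF smV] transpose_simps matrix_transpose_mul 2 NT MT matrix_mul_assoc add.commute)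
    ultimately show "cov_deriv_along sym_space_christoffel \<gamma> V t \<in> tangent_space_of sym_space (\<gamma> t)"
      by (simp add: tangent_space_of_sym_space[OF inS] M_def)
  }
  note tangent = this
  fix V W t assume V: "tangent_field_along sym_space \<gamma> V" and W: "tangent_field_along sym_space \<gamma> W"
  have smV: "smooth_on UNIV V" and smW: "smooth_on UNIV W" using field[OF V] field[OF W] by auto
  let ?k = "real CARD('k) / 2"
  have metric: "killing_metric (\<gamma> t) H K = ?k * trace (M t ** H ** M t ** K)"
    if "H \<in> tangent_space_of sym_space (\<gamma> t)" for H K t
    using that unfolding M_def
    by (intro killing_metric_eq inS) (simp add: tangent_space_of_sym_space[OF inS])
  have Vt: "V s \<in> tangent_space_of sym_space (\<gamma> s)" for s
    using V by (simp add: tangent_field_along_def)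
  let ?f = "\<lambda>s. (M s ** V s) ** (M s ** W s)"
  have smf: "smooth_on UNIV ?f"
    by (intro smooth_on_bilinear[OF bounded_bilinear_matrix_mult] sm_MV smV smW) auto
  have "((\<lambda>s. trace (?f s)) has_real_derivative trace (dir_deriv ?f 1 t)) (at t)"
    using smooth_on_has_real_derivative[OF smooth_on_linear[OF bounded_linear_trace open_UNIV smf], of t]
    by (simp add: dir_deriv_linear[OF bounded_linear_trace smf UNIV_I])
  then have "((\<lambda>s. ?k * trace (?f s)) has_real_derivative ?k * trace (dir_deriv ?f 1 t)) (at t)"
    by (rule DERIV_cmult)
  moreover have "(\<lambda>s. killing_metric (\<gamma> s) (V s) (W s)) = (\<lambda>s. ?k * trace (?f s))"
    by (simp add: metric Vt matrix_mul_assoc fun_eq_iff)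
  moreover have "?k * trace (dir_deriv ?f 1 t) =
      killing_metric (\<gamma> t) (cov_deriv_along sym_space_christoffel \<gamma> V t) (W t)
      + killing_metric (\<gamma> t) (V t) (cov_deriv_along sym_space_christoffel \<gamma> W t)"
  proof -
    \<comment> \<open>The averages leave a half term with N at either end of the product; cyclicity
      merges the two.\<close>
    have "trace (M t ** V t ** M t ** W t ** M t ** N t) = trace (M t ** N t ** M t ** V t ** M t ** W t)"
      using trace_mul_sym[of "M t ** V t ** M t ** W t" "M t ** N t"] by (simp add: matrix_mul_assoc)
    moreover have "dir_deriv ?f 1 t = M t ** V t ** dir_deriv (\<lambda>s. M s ** W s) 1 t
        + dir_deriv (\<lambda>s. M s ** V s) 1 t ** (M t ** W t)"
      by (rule dir_deriv_bilinear[OF bounded_bilinear_matrix_mult sm_MV[OF smV] sm_MV[OF smW] UNIV_I])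
    ultimately show ?thesis
      unfolding metric[OF tangent[OF V]] metric[OF Vt]
      by (simp only: dMV smV smW cov matrix_mult_simps trace_simps matrix_mul_assoc)
        (simp add: field_simps)
  qed
  ultimately show "((\<lambda>s. killing_metric (\<gamma> s) (V s) (W s)) has_real_derivative
      killing_metric (\<gamma> t) (cov_deriv_along sym_space_christoffel \<gamma> V t) (W t)
      + killing_metric (\<gamma> t) (V t) (cov_deriv_along sym_space_christoffel \<gamma> W t)) (at t)"
    by (simp only:)
qed

text \<open>The values are claimed on tangent vectors, where \<open>levi_civita\<close> determines
  them.\<close>

lemma christoffel_sym_space:
  fixes Q H K :: "real^'k::finite^'k"
  assumes Q: "Q \<in> sym_space"
    and H: "H \<in> tangent_space_of sym_space Q" and K: "K \<in> tangent_space_of sym_space Q"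
  shows "christoffel sym_space killing_metric Q H K = sym_space_christoffel Q H K"
proof (rule christoffel_eq[OF levi_civita_sym_space_christoffel])
  fix \<Gamma>' :: "real^'k^'k \<Rightarrow> real^'k^'k \<Rightarrow> real^'k^'k \<Rightarrow> real^'k^'k"
  assume \<Gamma>': "levi_civita sym_space killing_metric \<Gamma>'"
  note T = tangent_space_of_sym_space[OF Q]
  note metric = killing_metric_eq[OF Q]
  show "\<Gamma>' Q H K = sym_space_christoffel Q H K"
  proof (rule levi_civita_unique[OF \<Gamma>' levi_civita_sym_space_christoffel Q _ _ _ _ _ H K])
    show "subspace (tangent_space_of sym_space Q)"
      unfolding T subspace_def by (simp add: transpose_simps matrix_mult_simps trace_simps)
    fix u v w assume uvw: "u \<in> tangent_space_of sym_space Q" "v \<in> tangent_space_of sym_space Q"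
      "w \<in> tangent_space_of sym_space Q"
    then show "killing_metric Q (u - v) w = killing_metric Q u w - killing_metric Q v w"
      by (simp add: T metric matrix_mult_simps trace_simps algebra_simps)
  next
    fix u v assume uv: "u \<in> tangent_space_of sym_space Q" "v \<in> tangent_space_of sym_space Q"
    have "trace (matrix_inv Q ** u ** matrix_inv Q ** v) = trace (matrix_inv Q ** v ** matrix_inv Q ** u)"
      using trace_mul_sym[of "matrix_inv Q ** u" "matrix_inv Q ** v"] by (simp add: matrix_mul_assoc)
    then show "killing_metric Q u v = killing_metric Q v u" using uv by (simp add: T metric)
  next
    show "killing_metric Q u u > 0" if "u \<in> tangent_space_of sym_space Q" "u \<noteq> 0" for u
      using killing_metric_pos[OF Q] that by (simp add: T)
  next
    fix \<gamma> :: "real \<Rightarrow> real^'k^'k" and v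
    assume "smooth_curve_in sym_space \<gamma>" and v: "v \<in> tangent_space_of sym_space (\<gamma> 0)"
    then have sm: "smooth_on UNIV \<gamma>" and inS: "\<And>t. \<gamma> t \<in> sym_space"
      by (auto simp: smooth_curve_in_def)
    \<comment> \<open>The constant matrix \<open>v\<close> stays symmetric but may lose the trace
      condition. As tr(Q^-1 Q) = k, subtracting this multiple of \<gamma> restores it, and at 0
      nothing is subtracted.\<close>
    let ?V = "\<lambda>t. v - (trace (matrix_inv (\<gamma> t) ** v) * inverse (real CARD('k))) *\<^sub>R \<gamma> t"
    have sm_V: "smooth_on UNIV (\<lambda>t. v + (- (trace (matrix_inv (\<gamma> t) ** v) * inverse (real CARD('k)))) *\<^sub>R \<gamma> t)"
      unfolding mult_minus_right[symmetric]
      by (intro smooth_on_add smooth_on_const smooth_on_bilinear[OF bounded_bilinear_scaleR] sm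
          smooth_on_mult smooth_on_linear[OF bounded_linear_trace]
          smooth_on_bilinear[OF bounded_bilinear_matrix_mult] smooth_on_matrix_inv)
        (simp_all add: sym_spaceD[OF inS])
    have "?V t \<in> tangent_space_of sym_space (\<gamma> t)" for t
      using v by (simp add: tangent_space_of_sym_space[OF inS] transpose_simps matrix_mult_simps trace_simps
          sym_spaceD[OF inS] matrix_inv trace_I)
    moreover have "?V 0 = v" using v by (simp add: tangent_space_of_sym_space[OF inS])
    ultimately show "\<exists>V. tangent_field_along sym_space \<gamma> V \<and> V 0 = v"
      using sm_V by (intro exI[of _ ?V]) (simp add: tangent_field_along_def)
  qed
qed

section \<open>The tension field\<close>

definition outer :: "real^'k \<Rightarrow> real^'k \<Rightarrow> real^'k^'k::finite" where
  "outer a b = (\<chi> i j. a $ i * b $ j)"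

lemma outer_mult_vector: "outer a b *v w = (b \<bullet> w) *\<^sub>R a"
  by (simp add: outer_def matrix_vector_mult_def vec_eq_iff inner_vec_def sum_distrib_left mult_ac)

lemma trace_outer_mult: "trace (outer a b ** T) = b \<bullet> (T *v a)"
  by (simp add: trace_def outer_def matrix_matrix_mult_def matrix_vector_mult_def inner_vec_def
      sum_distrib_left mult_ac) (rule sum.swap)

lemma bounded_bilinear_outer: "bounded_bilinear (outer :: real^'k::finite \<Rightarrow> _)"
  unfolding bilinear_conv_bounded_bilinear[symmetric] bilinear_def linear_iff
  by (simp add: outer_def vec_eq_iff algebra_simps)

text \<open>The dual scalar product, for a frame in which \<open>f\<close> is a unit vector
  orthogonal to the image of \<open>L\<close> and \<open>B\<close> is the metric on that image. It
  contains the frame vectors and not the dual frame, so traces and smoothness can be read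
  off.\<close>

definition frame_dual_metric ::
    "real^'n^'n \<Rightarrow> (real^'n \<Rightarrow> real^'k) \<Rightarrow> real^'k \<Rightarrow> real^'k^'k::finite" where
  "frame_dual_metric B L f = (\<Sum>i\<in>UNIV. \<Sum>j\<in>UNIV.
     matrix_inv B $ i $ j *\<^sub>R outer (L (axis i 1)) (L (axis j (1::real)))) + outer f f"

text \<open>The product of the candidate with \<open>Q\<close> fixes all L u and f, and these
  span.\<close>

lemma matrix_inv_frame_dual_metric:
  fixes Q :: "real^'k::finite^'k" and B :: "real^'n::finite^'n"
  assumes L: "linear L" and span: "\<And>w. \<exists>u b. w = L u + b *\<^sub>R f" and det: "det B \<noteq> 0"
    and Q: "transpose Q = Q" "\<And>u v. scalar_prod Q (L u) (L v) = scalar_prod B u v"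
      "\<And>u. scalar_prod Q (L u) f = 0" "scalar_prod Q f f = 1"
  shows "matrix_inv Q = frame_dual_metric B L f"
proof -
  let ?R = "frame_dual_metric B L f"
  have R: "?R *v w = (\<Sum>i\<in>UNIV. \<Sum>j\<in>UNIV. (matrix_inv B $ i $ j * (L (axis j 1) \<bullet> w)) *\<^sub>R L (axis i 1))
      + (f \<bullet> w) *\<^sub>R f" for w
    unfolding frame_dual_metric_def
    by (simp add: bounded_bilinear.sum_left[OF bounded_bilinear_matrix_vector_mult]
        matrix_vector_mult_simps outer_mult_vector)
  have fQ: "f \<bullet> (Q *v L u) = 0" for u
    using Q(3)[of u] scalar_prod_commute[OF Q(1), of "L u" f] by (simp add: scalar_prod_def)
  have "(?R ** Q) *v w = mat 1 *v w" for w
  proof -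
    obtain u b where w: "w = L u + b *\<^sub>R f" using span by blast
    have "?R *v (Q *v L u) = (\<Sum>i\<in>UNIV. \<Sum>j\<in>UNIV. (matrix_inv B $ i $ j * scalar_prod B (axis j 1) u) *\<^sub>R L (axis i 1))"
      using Q(2)[of _ u] by (simp add: R fQ scalar_prod_def)
    also have "\<dots> = (\<Sum>i\<in>UNIV. (matrix_inv B *v (B *v u)) $ i *\<^sub>R L (axis i 1))"
      by (simp add: scalar_prod_def inner_axis' matrix_vector_mult_def[of "matrix_inv B"]
          scaleR_sum_left)
    also have "\<dots> = L (\<Sum>i\<in>UNIV. u $ i *\<^sub>R axis i 1)"
      by (simp add: matrix_inv_vector[OF det] linear_sum[OF L] linear_cmul[OF L])
    also have "(\<Sum>i\<in>UNIV. u $ i *\<^sub>R axis i 1) = u"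
      using basis_expansion[of u] by (simp add: scalar_mult_eq_scaleR)
    finally have "?R *v (Q *v L u) = L u" .
    moreover have "?R *v (Q *v f) = f"
      using Q(3,4) by (simp add: R scalar_prod_def)
    ultimately show ?thesis
      by (simp add: w matrix_vector_mul_assoc[symmetric] matrix_vector_mult_simps)
  qed
  then have "?R ** Q = mat 1" by (simp add: matrix_eq)
  then show ?thesis by (intro matrix_inv_unique) (simp add: matrix_left_right_inverse)
qed

text \<open>Collects the pointwise facts about one chart, so that the computation of the tension
  field is free of manifolds, volume forms and the definition of the lift.\<close>

locale blaschke_chart = metric_on U h G
  for U :: "(real^'n::finite) set" and h and G +
  fixes F :: "real^'n \<Rightarrow> real^'k::finite" and Q :: "real^'n \<Rightarrow> real^'k^'k"
  assumes F: "smooth_on U F" and Q: "smooth_on U Q" and Q_sym_space: "\<And>x. x \<in> U \<Longrightarrow> Q x \<in> sym_space"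
    and Q_tangent: "\<And>x u v. x \<in> U \<Longrightarrow>
      scalar_prod (Q x) (dir_deriv F u x) (dir_deriv F v x) = scalar_prod (G x) u v"
    and Q_normal: "\<And>x u. x \<in> U \<Longrightarrow> scalar_prod (Q x) (dir_deriv F u x) (F x) = 0"
    and Q_unit: "\<And>x. x \<in> U \<Longrightarrow> scalar_prod (Q x) (F x) (F x) = 1"
    and hessian: "\<And>x u v. x \<in> U \<Longrightarrow>
      scalar_prod (Q x) (dir_deriv (\<lambda>y. dir_deriv F u y) v x) (F x) = scalar_prod (G x) v u"
    and frame_span: "\<And>x w. x \<in> U \<Longrightarrow> \<exists>u b. w = dir_deriv F u x + b *\<^sub>R F x"
begin

section \<open>First and second derivatives of \<open>F\<close> and \<open>Q\<close> on a
  chart\<close>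

abbreviation "F1 u x \<equiv> dir_deriv F u x"
abbreviation "F2 u v x \<equiv> dir_deriv (\<lambda>y. dir_deriv F v y) u x"
abbreviation "Q1 u x \<equiv> dir_deriv Q u x"
abbreviation "Q2 u v x \<equiv> dir_deriv (\<lambda>y. dir_deriv Q v y) u x"

lemmas smooth_F1 = smooth_on_dir_deriv[OF F]
lemmas smooth_Q1 = smooth_on_dir_deriv[OF Q]

lemma Q_symmetric: "x \<in> U \<Longrightarrow> transpose (Q x) = Q x"
  and det_Q: "x \<in> U \<Longrightarrow> det (Q x) = 1"
  using sym_spaceD[OF Q_sym_space] by auto

lemma Q_comm: "x \<in> U \<Longrightarrow> a \<bullet> (Q x *v b) = b \<bullet> (Q x *v a)"
  using scalar_prod_commute[OF Q_symmetric] by (simp add: scalar_prod_def)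

lemma Q1_symmetric: "x \<in> U \<Longrightarrow> transpose (Q1 u x) = Q1 u x"
  by (rule transpose_dir_deriv[OF U _ Q Q_symmetric])

lemma Q1_comm: "x \<in> U \<Longrightarrow> a \<bullet> (Q1 u x *v b) = b \<bullet> (Q1 u x *v a)"
  using scalar_prod_commute[OF Q1_symmetric] by (simp add: scalar_prod_def)

lemma Q2_symmetric: "x \<in> U \<Longrightarrow> transpose (Q2 u v x) = Q2 u v x"
  by (rule transpose_dir_deriv[OF U _ smooth_Q1 Q1_symmetric])

lemma F2_commute: "x \<in> U \<Longrightarrow> F2 u v x = F2 v u x"
  by (rule dir_deriv_commute[OF U _ F])

lemma Q2_commute: "x \<in> U \<Longrightarrow> Q2 u v x = Q2 v u x"
  by (rule dir_deriv_commute[OF U _ Q])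

lemma dir_deriv_cong: "x \<in> U \<Longrightarrow> (\<And>y. y \<in> U \<Longrightarrow> f y = g y) \<Longrightarrow> dir_deriv f u x = dir_deriv g u x"
  using frechet_derivative_cong_open[OF U] by metis

lemma dir_deriv_mult_vector:
  fixes M :: "real^'n \<Rightarrow> real^'a::finite^'b::finite"
  assumes "x \<in> U" "smooth_on U M" "smooth_on U a"
  shows "dir_deriv (\<lambda>y. M y *v a y) u x = M x *v dir_deriv a u x + dir_deriv M u x *v a x"
  by (rule dir_deriv_bilinear[OF bounded_bilinear_matrix_vector_mult assms(2,3,1)])

lemma dir_deriv_Q_inner:
  assumes "x \<in> U" "smooth_on U a" "smooth_on U b"
  shows "dir_deriv (\<lambda>y. a y \<bullet> (Q y *v b y)) u x =
    a x \<bullet> (Q x *v dir_deriv b u x) + a x \<bullet> (Q1 u x *v b x) + dir_deriv a u x \<bullet> (Q x *v b x)"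
  by (simp add: dir_deriv_bilinear[OF bounded_bilinear_inner assms(2) _ assms(1)] inner_add_right
      smooth_on_bilinear[OF bounded_bilinear_matrix_vector_mult U Q assms(3)]
      dir_deriv_mult_vector[OF assms(1) Q assms(3)])

text \<open>The difference d is a combination of frame vectors, so vanishing against the frame gives
  |d|^2 = 0. The test uses the standard inner product because it is applied to covectors such as Q
  v.\<close>

lemma frame_eqI:
  assumes "x \<in> U" "\<And>u. F1 u x \<bullet> a = F1 u x \<bullet> b" "F x \<bullet> a = F x \<bullet> b"
  shows "a = b"
proof -
  define d where "d = a - b"
  obtain u c where "d = F1 u x + c *\<^sub>R F x" using frame_span[OF assms(1)] by blast
  then have "d \<bullet> d = F1 u x \<bullet> d + c * (F x \<bullet> d)" by (metis inner_add_left inner_scaleR_left)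
  also have "\<dots> = 0" using assms(2)[of u] assms(3) by (simp add: d_def inner_diff_right)
  finally show ?thesis by (simp add: d_def)
qed

text \<open>The factor 2 arises when Q(E_v, f) = 0 is differentiated along u: the derivative of f
  contributes h(u, v), and by \<open>hessian\<close> the derivative of E_v contributes it once
  more.\<close>

lemma Q1_F: assumes x: "x \<in> U" shows "Q1 u x *v F x = - 2 *\<^sub>R (Q x *v F1 u x)"
proof (rule frame_eqI[OF x])
  have "dir_deriv (\<lambda>y. F y \<bullet> (Q y *v F y)) u x = dir_deriv (\<lambda>y. 1) u x"
    using x Q_unit by (intro dir_deriv_cong) (auto simp: scalar_prod_def)
  then show "F x \<bullet> (Q1 u x *v F x) = F x \<bullet> (- 2 *\<^sub>R (Q x *v F1 u x))"
    using Q_normal[OF x, of u] Q_comm[OF x, of "F x" "F1 u x"]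
    by (simp add: dir_deriv_Q_inner[OF x F F] scalar_prod_def)
  fix v
  have "dir_deriv (\<lambda>y. F1 v y \<bullet> (Q y *v F y)) u x = dir_deriv (\<lambda>y. 0) u x"
    using x Q_normal by (intro dir_deriv_cong) (auto simp: scalar_prod_def)
  then show "F1 v x \<bullet> (Q1 u x *v F x) = F1 v x \<bullet> (- 2 *\<^sub>R (Q x *v F1 u x))"
    using hessian[OF x, of v u] Q_tangent[OF x, of v u] scalar_prod_commute[OF G_sym[OF x], of u v]
    by (simp add: dir_deriv_Q_inner[OF x smooth_F1 F] scalar_prod_def)
qed

lemma Q2_F':
  assumes x: "x \<in> U"
  shows "Q2 u v x *v F x + Q1 v x *v F1 u x = - 2 *\<^sub>R (Q x *v F2 u v x + Q1 u x *v F1 v x)"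
proof -
  have "dir_deriv (\<lambda>y. Q1 v y *v F y) u x = dir_deriv (\<lambda>y. - 2 *\<^sub>R (Q y *v F1 v y)) u x"
    by (intro dir_deriv_cong x Q1_F)
  also have "\<dots> = - 2 *\<^sub>R dir_deriv (\<lambda>y. Q y *v F1 v y) u x"
    by (rule dir_deriv_linear[OF bounded_linear_scaleR_right _ x])
      (rule smooth_on_bilinear[OF bounded_bilinear_matrix_vector_mult U Q smooth_F1])
  finally show ?thesis
    by (simp add: dir_deriv_mult_vector[OF x smooth_Q1 F] dir_deriv_mult_vector[OF x Q smooth_F1]
        add.commute)
qed

text \<open>Equality of mixed partial derivatives of \<open>F\<close> and \<open>Q\<close> gives the Codazzi equation: the cubic
  form \<open>(\<partial>\<^sub>u Q)(\<partial>\<^sub>v F, \<partial>\<^sub>w F)\<close> is totally symmetric.\<close>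

lemma codazzi: assumes x: "x \<in> U" shows "Q1 u x *v F1 v x = Q1 v x *v F1 u x"
proof -
  \<comment> \<open>For d = q_u E_v - q_v E_u the two instances differ by d on the left and by 2d on
    the right, since the second derivatives are symmetric; hence d = 0.\<close>
  have "(Q1 u x *v F1 v x) $ i = (Q1 v x *v F1 u x) $ i" for i
    using arg_cong[OF Q2_F'[OF x, of u v], of "\<lambda>w. w $ i"] arg_cong[OF Q2_F'[OF x, of v u], of "\<lambda>w. w $ i"]
    by (simp add: F2_commute[OF x, of v u] Q2_commute[OF x, of v u])
  then show ?thesis by (simp add: vec_eq_iff)
qed

text \<open>The coefficient 3 is the 2 on the right of \<open>Q2_F'\<close> plus the 1 moved over
  from its left by the Codazzi equation.\<close>

lemma Q2_F:
  assumes x: "x \<in> U"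
  shows "Q2 u v x *v F x = - 3 *\<^sub>R (Q1 u x *v F1 v x) - 2 *\<^sub>R (Q x *v F2 u v x)"
proof -
  have "(Q2 u v x *v F x) $ i = (- 3 *\<^sub>R (Q1 u x *v F1 v x) - 2 *\<^sub>R (Q x *v F2 u v x)) $ i" for i
    using arg_cong[OF Q2_F'[OF x, of v u], of "\<lambda>w. w $ i"] by (simp add: codazzi[OF x, of u v])
  then show ?thesis by (simp add: vec_eq_iff)
qed

lemma deriv_metric:
  assumes x: "x \<in> U"
  shows "scalar_prod (dir_deriv G u x) v w = F1 v x \<bullet> (Q x *v F2 u w x) + F1 v x \<bullet> (Q1 u x *v F1 w x)
    + F1 w x \<bullet> (Q x *v F2 u v x)"
proof -
  have "dir_deriv (\<lambda>y. v \<bullet> (G y *v w)) u x = dir_deriv (\<lambda>y. F1 v y \<bullet> (Q y *v F1 w y)) u x"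
    using x Q_tangent by (intro dir_deriv_cong) (auto simp: scalar_prod_def)
  moreover have "bounded_linear (\<lambda>M. v \<bullet> (M *v w))"
    by (intro bounded_linear_compose[OF bounded_linear_inner_right]
        bounded_bilinear.bounded_linear_left[OF bounded_bilinear_matrix_vector_mult])
  ultimately show ?thesis
    using dir_deriv_linear[OF _ G x, of "\<lambda>M. v \<bullet> (M *v w)" u]
    by (simp add: dir_deriv_Q_inner[OF x smooth_F1 smooth_F1] scalar_prod_def Q_comm[OF x, of "F1 w x"])
qed

text \<open>Both sides are compared after applying \<open>Q\<close>. Against f, the value h(u, v) of
  the Hessian cancels half of -2 h(u, v). Against E_w the Koszul formula applies, where the Codazzi
  equation merges the three cubic terms into one.\<close>

lemma F1_christoffel:
  assumes x: "x \<in> U"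
  shows "F1 (metric_christoffel G x u v) x = F2 u v x + (1/2) *\<^sub>R (matrix_inv (Q x) *v (Q1 u x *v F1 v x))"
proof -
  let ?L = "metric_christoffel G x u v"
  have "Q x *v F1 ?L x = Q x *v F2 u v x + (1/2) *\<^sub>R (Q1 u x *v F1 v x)"
  proof (rule frame_eqI[OF x])
    have "F x \<bullet> (Q1 u x *v F1 v x) = -2 * scalar_prod (G x) u v"
      using Q_tangent[OF x, of v u] scalar_prod_commute[OF G_sym[OF x], of u v]
      by (simp add: Q1_comm[OF x, of "F x"] Q1_F[OF x] scalar_prod_def)
    moreover have "F x \<bullet> (Q x *v F2 u v x) = scalar_prod (G x) u v"
      using hessian[OF x, of v u] by (simp add: scalar_prod_def Q_comm[OF x, of "F x"])
    moreover have "F x \<bullet> (Q x *v F1 ?L x) = 0"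
      using Q_normal[OF x, of ?L] by (simp add: scalar_prod_def Q_comm[OF x, of "F x"])
    ultimately show "F x \<bullet> (Q x *v F1 ?L x) = F x \<bullet> (Q x *v F2 u v x + (1/2) *\<^sub>R (Q1 u x *v F1 v x))"
      by (simp add: inner_simps)
    fix w
    have C: "F1 v x \<bullet> (Q1 u x *v F1 w x) = F1 w x \<bullet> (Q1 u x *v F1 v x)"
      "F1 u x \<bullet> (Q1 v x *v F1 w x) = F1 w x \<bullet> (Q1 u x *v F1 v x)"
      "F1 u x \<bullet> (Q1 w x *v F1 v x) = F1 w x \<bullet> (Q1 u x *v F1 v x)"
      by (metis Q1_comm[OF x] codazzi[OF x])+
    have "F1 w x \<bullet> (Q x *v F1 ?L x) = scalar_prod (G x) ?L w"
      using Q_tangent[OF x, of ?L w] by (simp add: scalar_prod_def Q_comm[OF x, of "F1 w x"])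
    then show "F1 w x \<bullet> (Q x *v F1 ?L x) = F1 w x \<bullet> (Q x *v F2 u v x + (1/2) *\<^sub>R (Q1 u x *v F1 v x))"
      by (simp add: koszul[OF x] deriv_metric[OF x] C inner_simps F2_commute[OF x, of v u]
          F2_commute[OF x, of w] field_simps)
  qed
  then have "matrix_inv (Q x) *v (Q x *v F1 ?L x) =
      matrix_inv (Q x) *v (Q x *v F2 u v x + (1/2) *\<^sub>R (Q1 u x *v F1 v x))" by simp
  then show ?thesis
    using det_Q[OF x] by (simp add: matrix_vector_mult_simps matrix_inv_vector)
qed

section \<open>The second fundamental form of the lift\<close>

definition T :: "real^'n \<Rightarrow> real^'n \<Rightarrow> real^'n \<Rightarrow> real^'k^'k" where
  "T x u v = Q2 u v x
    - (1/2) *\<^sub>R (Q1 u x ** matrix_inv (Q x) ** Q1 v x + Q1 v x ** matrix_inv (Q x) ** Q1 u x)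
    - Q1 (metric_christoffel G x u v) x"

text \<open>This allows \<open>christoffel_sym_space\<close> to be applied to the derivatives of
  \<open>Q\<close>.\<close>

lemma Q1_tangent: "x \<in> U \<Longrightarrow> Q1 u x \<in> tangent_space_of sym_space (Q x)"
proof (intro tangent_space_of_sym_spaceI Q_sym_space Q1_symmetric)
  assume x: "x \<in> U"
  have "dir_deriv (\<lambda>y. det (Q y)) u x = det (Q x) * trace (matrix_inv (Q x) ** Q1 u x)"
    by (rule dir_deriv_eqI[OF has_derivative_det[OF smooth_on_has_derivative[OF Q x]]])
      (simp add: det_Q[OF x])
  moreover have "dir_deriv (\<lambda>y. det (Q y)) u x = dir_deriv (\<lambda>y. 1) u x"
    by (intro dir_deriv_cong x det_Q)
  ultimately show "trace (matrix_inv (Q x) ** Q1 u x) = 0" by (simp add: det_Q[OF x])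
qed

lemma second_fundamental_form_eq_T:
  assumes x: "x \<in> U"
  shows "second_fundamental_form (christoffel U h) (christoffel sym_space killing_metric) Q
    (\<lambda>_. u) (\<lambda>_. v) x = T x u v"
  by (simp add: second_fundamental_form_def Let_def cov_deriv_def T_def sym_space_christoffel_def
      christoffel_sym_space[OF Q_sym_space[OF x] Q1_tangent[OF x] Q1_tangent[OF x]]
      christoffel_eq_metric_christoffel[OF x])

lemma T_commute: "x \<in> U \<Longrightarrow> T x u v = T x v u"
  using levi_civita_torsion_free[OF levi_civita_metric_christoffel, of x u v]
  by (simp add: T_def Q2_commute[of x u v] tangent_space_of_open[OF U] add.commute)

lemma T_symmetric: "x \<in> U \<Longrightarrow> transpose (T x u v) = T x u v"
  by (simp add: T_def transpose_simps matrix_transpose_mul Q1_symmetric Q2_symmetric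
      transpose_matrix_inv_sym_space Q_sym_space matrix_mul_assoc add.commute)

text \<open>Put c = q_u E_v and D = D_u E_v. The second derivative of Q contributes -3c - 2QD, the
  connection of the target 2c, and the connection of h contributes 2QD + c.\<close>

lemma T_F: "x \<in> U \<Longrightarrow> T x u v *v F x = 0"
  by (simp add: T_def matrix_vector_mult_simps matrix_vector_mul_assoc[symmetric] Q2_F Q1_F
      matrix_inv_vector det_Q F1_christoffel codazzi[of x v u])
    (simp add: vec_eq_iff)

text \<open>Differentiating the Codazzi equation along u leaves q_w D_u E_v - q_v D_u E_w. The
  connection term of h, rewritten as q_w E(L(u, v)), removes the first of these by
  \<open>F1_christoffel\<close>, and what remains is symmetric in v and w.\<close>

lemma T_codazzi:
  assumes x: "x \<in> U"
  shows "T x u v *v F1 w x = T x u w *v F1 v x"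
proof -
  have "dir_deriv (\<lambda>y. Q1 v y *v F1 w y) u x = dir_deriv (\<lambda>y. Q1 w y *v F1 v y) u x"
    by (intro dir_deriv_cong x codazzi)
  then have 1: "Q2 u v x *v F1 w x = Q2 u w x *v F1 v x + Q1 w x *v F2 u v x - Q1 v x *v F2 u w x"
    by (simp add: dir_deriv_mult_vector[OF x smooth_Q1 smooth_F1] algebra_simps)
  show ?thesis
    by (simp add: T_def matrix_vector_mult_simps matrix_vector_mul_assoc[symmetric] 1
        codazzi[OF x, of w v] codazzi[OF x, of "metric_christoffel G x _ _"] F1_christoffel[OF x]
        algebra_simps)
qed

text \<open>Differentiate tr(Q^-1 q_v) = 0 along u. The derivative of Q^-1 produces tr(Q^-1 q_u Q^-1
  q_v), which the quadratic terms of \<open>T\<close> cancel; the connection term of h is trace-free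
  by the same identity.\<close>

lemma trace_T:
  assumes x: "x \<in> U"
  shows "trace (matrix_inv (Q x) ** T x u v) = 0"
proof -
  let ?I = "\<lambda>y. matrix_inv (Q y)"
  have tr: "trace (?I y ** Q1 w y) = 0" if "y \<in> U" for w y
    using Q1_tangent[OF that, of w] by (simp add: tangent_space_of_sym_space Q_sym_space that)
  have "det (Q y) \<noteq> 0" if "y \<in> U" for y using det_Q[OF that] by simp
  then have sm: "smooth_on U ?I" and dI: "dir_deriv ?I u x = - (?I x ** Q1 u x ** ?I x)"
    by (auto intro!: smooth_on_matrix_inv dir_deriv_matrix_inv U Q x)
  have smIQ: "smooth_on U (\<lambda>y. ?I y ** Q1 v y)"
    by (intro smooth_on_bilinear[OF bounded_bilinear_matrix_mult] sm U smooth_Q1)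
  have "dir_deriv (\<lambda>y. trace (?I y ** Q1 v y)) u x = dir_deriv (\<lambda>y. 0) u x"
    by (intro dir_deriv_cong x tr)
  then have "trace (dir_deriv (\<lambda>y. ?I y ** Q1 v y) u x) = 0"
    by (simp add: dir_deriv_linear[OF bounded_linear_trace smIQ x])
  then have "trace (?I x ** Q2 u v x) = trace (?I x ** Q1 u x ** ?I x ** Q1 v x)"
    by (simp add: dir_deriv_bilinear[OF bounded_bilinear_matrix_mult sm smooth_Q1 x] dI
        matrix_mult_simps trace_simps)
  moreover have "trace (?I x ** Q1 v x ** ?I x ** Q1 u x) = trace (?I x ** Q1 u x ** ?I x ** Q1 v x)"
    using trace_mul_sym[of "?I x ** Q1 v x" "?I x ** Q1 u x"] by (simp add: matrix_mul_assoc)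
  ultimately show ?thesis
    by (simp add: T_def matrix_mult_simps trace_simps matrix_mul_assoc tr[OF x])
qed

lemma inverse_Q: "x \<in> U \<Longrightarrow> matrix_inv (Q x) = frame_dual_metric (G x) (\<lambda>u. F1 u x) (F x)"
  by (intro matrix_inv_frame_dual_metric smooth_on_linear_derivative[OF F] frame_span det_G
      Q_symmetric Q_tangent Q_normal Q_unit)

text \<open>\<open>T(u, v)\<close> annihilates \<open>F\<close> and is totally symmetric on the tangent frame, so contracting the
  slots \<open>u, v\<close> with the inverse metric amounts to taking a trace with respect to \<open>Q\<close>.\<close>

lemma tension_field_eq_0:
  assumes x: "x \<in> U"
  shows "tension_field U h sym_space killing_metric Q x = 0"
proof -
  let ?g = "matrix_inv (G x)" and ?e = "\<lambda>i. axis i 1 :: real^'n"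
  define S where "S = (\<Sum>i\<in>UNIV. \<Sum>j\<in>UNIV. ?g $ i $ j *\<^sub>R T x (?e i) (?e j))"
  have "gram (h x) = G x"
    by (simp add: gram_def h[OF x] scalar_prod_axis vec_eq_iff)
  then have S: "tension_field U h sym_space killing_metric Q x = S"
    by (simp add: tension_field_def second_fundamental_form_eq_T[OF x] S_def)
  have S_mult: "S *v w = (\<Sum>i\<in>UNIV. \<Sum>j\<in>UNIV. ?g $ i $ j *\<^sub>R (T x (?e i) (?e j) *v w))" for w
    unfolding S_def by (simp add: bounded_bilinear.sum_left[OF bounded_bilinear_matrix_vector_mult]
        matrix_vector_mult_simps)
  have S_F: "S *v F x = 0" by (simp add: S_mult T_F[OF x])
  have T_comm: "a \<bullet> (T x u v *v b) = b \<bullet> (T x u v *v a)" for a b u v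
    using scalar_prod_commute[OF T_symmetric[OF x]] by (simp add: scalar_prod_def)
  \<comment> \<open>Total symmetry exchanges the pair \<open>a\<close>, \<open>b\<close> with the
    pair \<open>u\<close>, \<open>v\<close>, so the contracted slots become the arguments of a fixed
    \<open>T x a b\<close>.\<close>
  have "F1 a x \<bullet> (T x u v *v F1 b x) = F1 v x \<bullet> (T x a b *v F1 u x)" for a b u v
    by (metis T_codazzi[OF x] T_commute[OF x] T_comm)
  then have "F1 a x \<bullet> (S *v F1 b x) =
      (\<Sum>i\<in>UNIV. \<Sum>j\<in>UNIV. ?g $ i $ j * (F1 (?e j) x \<bullet> (T x a b *v F1 (?e i) x)))" for a b
    unfolding S_mult inner_sum_right inner_scaleR_right by (intro sum.cong refl arg_cong2[of _ _ _ _ "(*)"])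
  \<comment> \<open>The summand f f^T of Q^-1 contributes nothing, as T(a, b) annihilates f.\<close>
  also have "\<dots> a b = trace (matrix_inv (Q x) ** T x a b)" for a b
    by (simp add: inverse_Q[OF x] frame_dual_metric_def matrix_mult_simps trace_simps
        bounded_bilinear.sum_left[OF bounded_bilinear_matrix_mult]
        linear_sum[OF bounded_linear.linear[OF bounded_linear_trace]] trace_outer_mult T_F[OF x])
  finally have S_tangent: "F1 a x \<bullet> (S *v F1 b x) = 0" for a b
    by (simp add: trace_T[OF x])
  have "S *v F1 b x = 0" for b
  proof (rule frame_eqI[OF x])
    have "transpose S = S"
      unfolding S_def
      by (simp add: linear_sum[OF bounded_linear.linear[OF bounded_linear_transpose]] transpose_simps
          T_symmetric[OF x])
    from scalar_prod_commute[OF this, of "F x" "F1 b x"]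
    show "F x \<bullet> (S *v F1 b x) = F x \<bullet> 0" by (simp add: scalar_prod_def S_F)
  qed (simp add: S_tangent)
  then have "S *v w = 0 *v w" for w
    using frame_span[OF x, of w] S_F by (auto simp: matrix_vector_mult_simps)
  then have "S = 0" by (simp only: matrix_eq simp_thms)
  then show ?thesis using S by simp
qed

end

section \<open>The Blaschke lift\<close>

lemma sum_option: "(\<Sum>a\<in>UNIV. g a) = g None + (\<Sum>i\<in>UNIV. g (Some (i :: 'n::finite)))"
  by (simp add: UNIV_option_conv sum.reindex)

lemma prod_option: "(\<Prod>a\<in>UNIV. g a) = g None * (\<Prod>i\<in>UNIV. g (Some (i :: 'n::finite)))"
  by (simp add: UNIV_option_conv prod.reindex)

lemma frame_matrix_mult:
  "frame_matrix W \<xi> *v y = (\<Sum>i\<in>UNIV. y $ Some i *\<^sub>R W i) + y $ None *\<^sub>R \<xi>"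
  by (simp add: frame_matrix_def matrix_vector_mult_def vec_eq_iff sum_option algebra_simps)

lemma gram_works:
  assumes "bilinear b"
  shows "b = scalar_prod (gram b)"
proof (intro ext)
  fix u v
  have lin: "linear (\<lambda>u. b u v)" "linear (b u)" for u v using assms by (auto simp: bilinear_def)
  have e: "w = (\<Sum>i\<in>UNIV. w $ i *\<^sub>R axis i 1)" for w :: "real^'a"
    using basis_expansion[of w] by (simp add: scalar_mult_eq_scaleR)
  have "b u v = b (\<Sum>i\<in>UNIV. u $ i *\<^sub>R axis i 1) (\<Sum>j\<in>UNIV. v $ j *\<^sub>R axis j 1)"
    using e[of u] e[of v] by simp
  also have "\<dots> = (\<Sum>i\<in>UNIV. \<Sum>j\<in>UNIV. u $ i * (v $ j * b (axis i 1) (axis j 1)))"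
    unfolding linear_sum[OF lin(1)] linear_cmul[OF lin(1)]
    unfolding linear_sum[OF lin(2)] linear_cmul[OF lin(2)]
    by (simp add: sum_distrib_left)
  also have "\<dots> = scalar_prod (gram b) u v"
    by (simp add: scalar_prod_def gram_def inner_vec_def matrix_vector_mult_def sum_distrib_left mult_ac)
  finally show "b u v = scalar_prod (gram b) u v" .
qed

text \<open>In an \<open>h\<close>-orthonormal frame the Blaschke condition says that the frame matrix has determinant
  \<open>\<plusminus>1\<close>. Hence \<open>Q(f, f) = 1\<close> for the Blaschke lift.\<close>

locale blaschke_frame =
  fixes b :: "real^'n::finite \<Rightarrow> real^'n \<Rightarrow> real" and L :: "real^'n \<Rightarrow> real^('n option)"
    and f :: "real^('n option)"
  assumes bilinear: "bilinear b" and sym: "\<And>u v. b u v = b v u" and pos: "\<And>u. u \<noteq> 0 \<Longrightarrow> b u u > 0"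
    and L: "linear L" and span: "\<And>w. \<exists>u c. w = L u + c *\<^sub>R f"
    and blaschke: "\<exists>s\<in>{1, -1}. \<forall>X. det (frame_matrix (\<lambda>i. L (X i)) f) = s * volume_form b X"
begin

lemma gram: "scalar_prod (gram b) u v = b u v"
  by (simp only: gram_works[OF bilinear, symmetric])

lemma gram_sym: "transpose (gram b) = gram b"
  by (simp add: vec_eq_iff transpose_def gram_def) (simp add: sym)

text \<open>For an orthonormal P the determinant of P^T B P = 1 gives det B (det P)^2 = 1, so the
  volume form takes the value 1 or -1 on the columns of P.\<close>

lemma unimodular_frame:
  obtains P :: "real^'n^'n" where "transpose P ** gram b ** P = mat 1"
    "\<bar>det (frame_matrix (\<lambda>i. L (P *v axis i 1)) f)\<bar> = 1"
proof -
  have gram_pos: "v \<noteq> 0 \<Longrightarrow> scalar_prod (gram b) v v > 0" for v by (simp add: gram pos)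
  obtain P :: "real^'n^'n" where P: "transpose P ** gram b ** P = mat 1"
    by (rule exists_orthonormal_frame[OF gram_sym gram_pos])
  have "(\<chi> a i. (P *v axis i 1) $ a) = P"
    by (simp add: vec_eq_iff matrix_vector_mult_basis column_def)
  then have vol: "volume_form b (\<lambda>i. P *v axis i 1) = sqrt (det (gram b)) * det P"
    by (simp add: volume_form_def)
  have 1: "det P * det (gram b) * det P = 1" using arg_cong[OF P, of det] by (simp add: det_mul)
  then have "det (gram b) * (det P)\<^sup>2 > 0" by (simp add: power2_eq_square mult_ac)
  then have "det (gram b) > 0" by (simp add: zero_less_mult_iff)
  then have "(sqrt (det (gram b)) * det P)\<^sup>2 = 1"
    using 1 by (simp add: power_mult_distrib power2_eq_square mult_ac)
  then have "\<bar>sqrt (det (gram b)) * det P\<bar> = 1" by (metis power2_eq_1_iff abs_1 abs_minus_cancel)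
  then have "\<bar>det (frame_matrix (\<lambda>i. L (P *v axis i 1)) f)\<bar> = 1"
    using blaschke vol by (auto simp: abs_mult)
  then show thesis by (rule that[OF P])
qed

text \<open>The condition in \<open>blaschke_lift\<close> as seen from a single chart; the lift has
  to satisfy it in all charts at once.\<close>

definition adapted :: "real^('n option)^('n option) \<Rightarrow> bool" where
  "adapted Q \<longleftrightarrow> Q \<in> sym_space \<and> (\<forall>u v. scalar_prod Q (L u) (L v) = b u v) \<and>
     (\<forall>u. scalar_prod Q (L u) f = 0)"

text \<open>The witness is the scalar product for which the unimodular frame is orthonormal, that
  is, \<open>orbit_map\<close> of the frame matrix.\<close>

lemma adapted_exists: "\<exists>Q. adapted Q"
proof -
  obtain P :: "real^'n^'n" where P: "transpose P ** gram b ** P = mat 1"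
    and M: "\<bar>det (frame_matrix (\<lambda>i. L (P *v axis i 1)) f)\<bar> = 1" by (rule unimodular_frame)
  let ?M = "frame_matrix (\<lambda>i. L (P *v axis i 1)) f"
  define \<iota> :: "real^'n \<Rightarrow> real^('n option)"
    where "\<iota> y = (\<chi> a. case a of Some i \<Rightarrow> y $ i | None \<Rightarrow> 0)" for y
  have nz: "det ?M \<noteq> 0" "det P \<noteq> 0"
    using M arg_cong[OF P, of det] by (auto simp: det_mul)
  have M\<iota>: "?M *v \<iota> y = L (P *v y)" for y
  proof -
    have "L (P *v (\<Sum>i\<in>UNIV. y $ i *\<^sub>R axis i 1)) = (\<Sum>i\<in>UNIV. y $ i *\<^sub>R L (P *v axis i 1))"
      by (simp add: bounded_bilinear.sum_right[OF bounded_bilinear_matrix_vector_mult]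
          matrix_vector_mult_simps linear_sum[OF L] linear_cmul[OF L])
    moreover have "(\<Sum>i\<in>UNIV. y $ i *\<^sub>R axis i 1) = y"
      using basis_expansion[of y] by (simp add: scalar_mult_eq_scaleR)
    ultimately show ?thesis by (simp add: frame_matrix_mult \<iota>_def)
  qed
  have inv_L: "matrix_inv ?M *v L u = \<iota> (matrix_inv P *v u)" for u
    using matrix_inv_vector(1)[OF nz(1), of "\<iota> (matrix_inv P *v u)"]
    by (simp add: M\<iota> matrix_inv_vector(2)[OF nz(2)])
  have "?M *v axis None 1 = f" by (simp add: frame_matrix_mult axis_def)
  then have inv_f: "matrix_inv ?M *v f = axis None 1" by (metis matrix_inv_vector(1)[OF nz(1)])
  have "scalar_prod (gram b) (P *v y) (P *v z) = y \<bullet> z" for y z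
    unfolding scalar_prod_transform P by (simp add: scalar_prod_def)
  from this[of "matrix_inv P *v _" "matrix_inv P *v _"]
  have "b u v = (matrix_inv P *v u) \<bullet> (matrix_inv P *v v)" for u v
    by (simp only: matrix_inv_vector(2)[OF nz(2)] gram)
  then have "adapted (orbit_map ?M)"
    unfolding adapted_def scalar_prod_orbit_map inv_L inv_f
    by (simp add: orbit_map_sym_space[OF M] inner_axis \<iota>_def) (simp add: inner_vec_def sum_option)
  then show ?thesis by blast
qed

text \<open>In the unimodular frame the Gram matrix of \<open>Q\<close> is diagonal with entries 1,
  ..., 1, Q(f, f), and its determinant is 1.\<close>

lemma adapted_unit:
  assumes "adapted Q"
  shows "scalar_prod Q f f = 1"
proof -
  obtain P :: "real^'n^'n" where P: "transpose P ** gram b ** P = mat 1"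
    and M: "\<bar>det (frame_matrix (\<lambda>i. L (P *v axis i 1)) f)\<bar> = 1" by (rule unimodular_frame)
  let ?M = "frame_matrix (\<lambda>i. L (P *v axis i 1)) f"
  let ?D = "transpose ?M ** Q ** ?M"
  have Q: "transpose Q = Q" "det Q = 1" "\<And>u v. scalar_prod Q (L u) (L v) = b u v"
    "\<And>u. scalar_prod Q (L u) f = 0" "\<And>u. scalar_prod Q f (L u) = 0"
    using assms scalar_prod_commute[of Q f] by (auto simp: adapted_def sym_spaceD)
  have col: "?M *v axis (Some i) 1 = L (P *v axis i 1)" "?M *v axis None 1 = f" for i
    by (simp_all add: frame_matrix_mult axis_def if_distrib[of "\<lambda>r. r *\<^sub>R _"] cong: if_cong)
  have D: "?D $ i $ j = scalar_prod Q (?M *v axis i 1) (?M *v axis j 1)" for i j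
    by (simp add: scalar_prod_transform scalar_prod_axis)
  have b: "b (P *v axis i 1) (P *v axis j 1) = (if i = j then 1 else 0)" for i j
  proof -
    have "b (P *v axis i 1) (P *v axis j 1) = scalar_prod (gram b) (P *v axis i 1) (P *v axis j 1)"
      by (simp add: gram)
    then show ?thesis by (simp add: scalar_prod_transform P scalar_prod_axis mat_def)
  qed
  have "det ?D = (\<Prod>i\<in>UNIV. ?D $ i $ i)"
  proof (rule det_diagonal)
    fix i j :: "'n option" assume "i \<noteq> j"
    then show "?D $ i $ j = 0"
      unfolding D by (cases i; cases j) (simp_all add: col Q b)
  qed
  also have "\<dots> = scalar_prod Q f f" unfolding D prod_option by (simp add: col Q b)
  also have "det ?D = 1" using M Q(2) by (simp add: det_mul flip: abs_mult_self_eq[of "det ?M"])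
  finally show ?thesis by simp
qed

lemma adapted_inverse: "adapted Q \<Longrightarrow> matrix_inv Q = frame_dual_metric (gram b) L f"
proof (rule matrix_inv_frame_dual_metric[OF L span])
  obtain P :: "real^'n^'n" where "transpose P ** gram b ** P = mat 1" by (rule unimodular_frame)
  from arg_cong[OF this, of det] show "det (gram b) \<noteq> 0" by (auto simp: det_mul)
qed (auto simp: adapted_def sym_spaceD adapted_unit gram)

text \<open>Serves twice: at most one adapted \<open>Q\<close> exists, and the lift is a smooth
  function of the metric and the frame.\<close>

lemma adapted_eq: "adapted Q \<Longrightarrow> Q = matrix_inv (frame_dual_metric (gram b) L f)"
  using adapted_inverse[of Q]
  by (metis adapted_def matrix_inv(2) matrix_inv_unique sym_spaceD(3) zero_neq_one)

end

section \<open>Charts, change of charts and the lift on the manifold\<close>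

lemma chart_inv_in:
  assumes "is_chart c" "x \<in> chart_image c"
  shows "chart_inv c x \<in> fst c" "snd c (chart_inv c x) = x"
  using assms by (auto simp: is_chart_def homeomorphism_def)

lemma chart_inv_apply: "is_chart c \<Longrightarrow> p \<in> fst c \<Longrightarrow> chart_inv c (snd c p) = p"
  by (auto simp: is_chart_def homeomorphism_def)

lemma chart_overlap_open:
  assumes "is_chart c" "is_chart d"
  shows "open (snd c ` (fst c \<inter> fst d))"
proof -
  have "openin (top_of_set (chart_image c)) (snd c ` (fst c \<inter> fst d))"
    using assms by (intro homeomorphism_imp_open_map[of "fst c" _ "snd c" "chart_inv c"])
      (auto simp: is_chart_def intro: openin_open_Int)
  then show ?thesis using assms(1) openin_open_eq by (auto simp: is_chart_def)
qed

locale affine_sphere =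
  fixes A :: "('m::topological_space, 'n::finite) chart set" and h :: "('m, 'n) tensor2"
    and f :: "'m \<Rightarrow> real^('n option)"
  assumes atlas: "oriented_smooth_atlas A" and sphere: "hyperbolic_affine_sphere A h f"
begin

abbreviation "rep c \<equiv> local_rep c f"

lemma chart: "c \<in> A \<Longrightarrow> is_chart c"
  using atlas by (auto simp: oriented_smooth_atlas_def)

lemma chart_image_open: "c \<in> A \<Longrightarrow> open (chart_image c)"
  using chart by (auto simp: is_chart_def)

lemma metric:
  assumes "c \<in> A"
  shows "smooth_on (chart_image c) (\<lambda>x. h c x u v)" "x \<in> chart_image c \<Longrightarrow> bilinear (h c x)"
    "x \<in> chart_image c \<Longrightarrow> h c x u v = h c x v u"
    "x \<in> chart_image c \<Longrightarrow> u \<noteq> 0 \<Longrightarrow> h c x u u > 0"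
  using sphere assms by (auto simp: hyperbolic_affine_sphere_def riemannian_metric_def)

lemma metric_transition:
  assumes "c \<in> A" "d \<in> A" "x \<in> snd c ` (fst c \<inter> fst d)"
  shows "h c x u v = h d (transition c d x)
    (dir_deriv (transition c d) u x) (dir_deriv (transition c d) v x)"
proof -
  have "riemannian_metric A h" using sphere by (simp add: hyperbolic_affine_sphere_def)
  then show ?thesis using assms unfolding riemannian_metric_def by blast
qed

lemma rep:
  assumes "c \<in> A"
  shows "smooth_on (chart_image c) (rep c)"
    "x \<in> chart_image c \<Longrightarrow> {a + b | a b. a \<in> range (frechet_derivative (rep c) (at x)) \<and> b \<in> span {rep c x}} = UNIV"
    "\<exists>\<Gamma>. \<forall>X Y. smooth_on (chart_image c) X \<longrightarrow> smooth_on (chart_image c) Y \<longrightarrow>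
      (\<forall>x\<in>chart_image c. dir_deriv (\<lambda>y. dir_deriv (rep c) (Y y) y) (X x) x =
        dir_deriv (rep c) (cov_deriv \<Gamma> X Y x) x + h c x (X x) (Y x) *\<^sub>R rep c x)"
    "x \<in> chart_image c \<Longrightarrow> \<exists>s\<in>{1, -1}. \<forall>X.
      det (frame_matrix (\<lambda>i. dir_deriv (rep c) (X i) x) (rep c x)) = s * volume_form (h c x) X"
  using sphere[unfolded hyperbolic_affine_sphere_def Let_def, THEN conjunct2, rule_format, OF assms]
  by blast+

lemma frame_span:
  assumes "c \<in> A" "x \<in> chart_image c"
  shows "\<exists>u b. w = dir_deriv (rep c) u x + b *\<^sub>R rep c x"
proof -
  have "w \<in> {a + b | a b. a \<in> range (frechet_derivative (rep c) (at x)) \<and> b \<in> span {rep c x}}"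
    using rep(2)[OF assms] by simp
  then show ?thesis by (auto simp: span_singleton)
qed

text \<open>Constant fields are inserted. The tangential part is kept as an unnamed w, since only
  its \<open>Q\<close>-orthogonality to f enters later.\<close>

lemma structure_equation:
  assumes "c \<in> A" "x \<in> chart_image c"
  shows "\<exists>w. dir_deriv (\<lambda>y. dir_deriv (rep c) u y) v x = dir_deriv (rep c) w x + h c x v u *\<^sub>R rep c x"
  using rep(3)[OF assms(1)] smooth_on_const assms(2) by blast

lemma frame: "c \<in> A \<Longrightarrow> x \<in> chart_image c \<Longrightarrow>
    blaschke_frame (h c x) (\<lambda>u. dir_deriv (rep c) u x) (rep c x)"
  by (rule blaschke_frame.intro)
    (rule metric(2-4) frame_span rep(4) smooth_on_linear_derivative[OF rep(1)]; assumption)+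

abbreviation "adapted_at c p \<equiv> blaschke_frame.adapted (h c (snd c p))
  (\<lambda>u. dir_deriv (rep c) u (snd c p)) (f p)"

lemma frame_at:
  assumes "c \<in> A" "p \<in> fst c"
  shows "blaschke_frame (h c (snd c p)) (\<lambda>u. dir_deriv (rep c) u (snd c p)) (f p)"
  using frame[OF assms(1), of "snd c p"] assms chart_inv_apply[OF chart[OF assms(1)] assms(2)]
  by (simp add: chart_image_def local_rep_def)

text \<open>By the chain rule the frame of \<open>c\<close> is that of \<open>d\<close> composed
  with the Jacobian of the transition map, and \<open>h\<close> transforms alike. The Jacobian is
  onto, so the conditions in \<open>c\<close> reach all tangent vectors in \<open>d\<close>.\<close>

lemma adapted_transition:
  assumes c: "c \<in> A" "p \<in> fst c" and d: "d \<in> A" "p \<in> fst d" and Q: "adapted_at c p Q"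
  shows "adapted_at d p Q"
proof -
  let ?x = "snd c p" and ?V = "snd c ` (fst c \<inter> fst d)" and ?\<tau> = "transition c d"
  let ?D = "frechet_derivative ?\<tau> (at ?x)"
  have x: "?x \<in> ?V" using c d by auto
  have \<tau>: "smooth_on ?V ?\<tau>" "det (matrix ?D) > 0"
    using atlas c d x by (auto simp: oriented_smooth_atlas_def)
  have \<tau>x: "?\<tau> ?x = snd d p"
    by (simp add: transition_def chart_inv_apply[OF chart] c)
  have "(rep d has_derivative (\<lambda>v. dir_deriv (rep d) v (snd d p))) (at (?\<tau> ?x))"
    unfolding \<tau>x by (rule smooth_on_has_derivative[OF rep(1)]) (use d in \<open>auto simp: chart_image_def\<close>)
  from diff_chain_at[OF smooth_on_has_derivative[OF \<tau>(1) x] this]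
  have der: "((\<lambda>z. rep d (?\<tau> z)) has_derivative (\<lambda>u. dir_deriv (rep d) (?D u) (snd d p))) (at ?x)"
    by (simp add: o_def)
  have "rep d (?\<tau> z) = rep c z" if "z \<in> ?V" for z
    using that chart_inv_apply[OF chart[OF c(1)]] chart_inv_apply[OF chart[OF d(1)]]
    by (auto simp: local_rep_def transition_def)
  from has_derivative_cong_open[OF chart_overlap_open[OF chart[OF c(1)] chart[OF d(1)]] x this,
      THEN iffD1, OF _ der]
  have "(rep c has_derivative (\<lambda>u. dir_deriv (rep d) (?D u) (snd d p))) (at ?x)" .
  then have chain: "dir_deriv (rep c) u ?x = dir_deriv (rep d) (?D u) (snd d p)" for u
    by (rule dir_deriv_eqI)
  have h: "h c ?x u v = h d (snd d p) (?D u) (?D v)" for u v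
    using metric_transition[OF c(1) d(1) x] by (simp add: \<tau>x)
  have surj: "\<exists>u. ?D u = w" for w
  proof -
    have "matrix ?D *v (matrix_inv (matrix ?D) *v w) = w" using \<tau>(2) by (intro matrix_inv_vector) simp
    moreover have "matrix ?D *v u = ?D u" for u
      using smooth_on_linear_derivative[OF \<tau>(1) x]
      by (simp add: matrix_works linear_matrix_vector_mul_eq)
    ultimately show ?thesis by metis
  qed
  have Qc: "Q \<in> sym_space" "scalar_prod Q (dir_deriv (rep c) u ?x) (dir_deriv (rep c) v ?x) = h c ?x u v"
    "scalar_prod Q (dir_deriv (rep c) u ?x) (f p) = 0" for u v
    using Q by (simp_all add: blaschke_frame.adapted_def[OF frame_at[OF c]])
  show ?thesis
    unfolding blaschke_frame.adapted_def[OF frame_at[OF d]]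
  proof (intro conjI allI Qc(1))
    fix u v
    obtain u' v' where "?D u' = u" "?D v' = v" using surj by metis
    then show "scalar_prod Q (dir_deriv (rep d) u (snd d p)) (dir_deriv (rep d) v (snd d p)) = h d (snd d p) u v"
      "scalar_prod Q (dir_deriv (rep d) u (snd d p)) (f p) = 0"
      using Qc(2)[of u' v'] Qc(3)[of u'] by (simp_all add: chain h)
  qed
qed

text \<open>Independence of the chart reduces the condition over all charts to one chart, where
  existence and uniqueness are known.\<close>

lemma blaschke_lift_adapted:
  assumes c: "c \<in> A" "p \<in> fst c"
  shows "adapted_at c p (blaschke_lift A h f p)"
proof -
  obtain Q where Q: "adapted_at c p Q"
    using blaschke_frame.adapted_exists[OF frame_at[OF c]] by blast
  have iff: "(Q' \<in> sym_space \<and> (\<forall>d\<in>A. p \<in> fst d \<longrightarrow>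
      (let x = snd d p; df = frechet_derivative (local_rep d f) (at x) in
        (\<forall>u v. scalar_prod Q' (df u) (df v) = h d x u v) \<and> (\<forall>u. scalar_prod Q' (df u) (f p) = 0))))
    \<longleftrightarrow> adapted_at c p Q'" (is "?P Q' \<longleftrightarrow> _") for Q'
  proof
    assume "?P Q'"
    then show "adapted_at c p Q'"
      using c by (simp add: blaschke_frame.adapted_def[OF frame_at[OF c]] Let_def)
  next
    assume Q': "adapted_at c p Q'"
    then have "Q' \<in> sym_space" by (simp add: blaschke_frame.adapted_def[OF frame_at[OF c]])
    moreover have "(\<forall>u v. scalar_prod Q' (dir_deriv (rep d) u (snd d p)) (dir_deriv (rep d) v (snd d p))
        = h d (snd d p) u v) \<and> (\<forall>u. scalar_prod Q' (dir_deriv (rep d) u (snd d p)) (f p) = 0)"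
      if d: "d \<in> A" "p \<in> fst d" for d
      using adapted_transition[OF c d Q'] by (simp add: blaschke_frame.adapted_def[OF frame_at[OF d]])
    ultimately show "?P Q'" by (simp add: Let_def)
  qed
  have "blaschke_lift A h f p = Q"
    unfolding blaschke_lift_def iff
    using Q blaschke_frame.adapted_eq[OF frame_at[OF c]] by (metis the_equality)
  then show ?thesis using Q by simp
qed

lemma harmonic: "harmonic_map A h sym_space killing_metric (blaschke_lift A h f)"
  unfolding harmonic_map_def
proof (intro conjI ballI)
  have "blaschke_lift A h f p \<in> sym_space" for p
  proof -
    have "p \<in> (\<Union>c\<in>A. fst c)" using atlas by (simp add: oriented_smooth_atlas_def)
    then obtain c where c: "c \<in> A" "p \<in> fst c" by (rule UN_E)
    then show ?thesis
      using blaschke_lift_adapted[OF c] by (simp add: blaschke_frame.adapted_def[OF frame_at[OF c]])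
  qed
  then show "range (blaschke_lift A h f) \<subseteq> sym_space" by auto
next
  fix c assume c: "c \<in> A"
  let ?U = "chart_image c" and ?Q = "local_rep c (blaschke_lift A h f)" and ?G = "\<lambda>x. gram (h c x)"
  have adapted: "blaschke_frame.adapted (h c x) (\<lambda>u. dir_deriv (rep c) u x) (rep c x) (?Q x)" if "x \<in> ?U" for x
    using blaschke_lift_adapted[OF c chart_inv_in(1)[OF chart[OF c] that]]
    by (simp add: chart_inv_in[OF chart[OF c] that] local_rep_def)
  have Q: "?Q x \<in> sym_space"
    "scalar_prod (?Q x) (dir_deriv (rep c) u x) (dir_deriv (rep c) v x) = h c x u v"
    "scalar_prod (?Q x) (dir_deriv (rep c) u x) (rep c x) = 0" if "x \<in> ?U" for x u v
    using adapted[OF that] by (simp_all add: blaschke_frame.adapted_def[OF frame[OF c that]])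
  have "smooth_on ?U ?G"
    unfolding gram_def by (intro smooth_on_vec_lambda chart_image_open c metric)
  then interpret metric_on ?U "h c" ?G
    using c by unfold_locales
      (auto simp: chart_image_open gram_works[OF metric(2)[OF c], symmetric] metric(4)
        blaschke_frame.gram_sym[OF frame])
  \<comment> \<open>The lift is given by \<open>THE\<close>, so its smoothness is read off from the
    closed formula in \<open>adapted_eq\<close>.\<close>
  have "smooth_on ?U (\<lambda>x. frame_dual_metric (?G x) (\<lambda>u. dir_deriv (rep c) u x) (rep c x))"
    unfolding frame_dual_metric_def
    by (intro smooth_on_add smooth_on_sum smooth_on_bilinear[OF bounded_bilinear_scaleR]
        smooth_on_bilinear[OF bounded_bilinear_outer] smooth_on_vec_nth smooth_on_matrix_inv
        smooth_on_dir_deriv rep(1)[OF c] U G det_G)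
  then have "smooth_on ?U (\<lambda>x. matrix_inv (frame_dual_metric (?G x) (\<lambda>u. dir_deriv (rep c) u x) (rep c x)))"
  proof (rule smooth_on_matrix_inv[OF U])
    fix x assume x: "x \<in> ?U"
    \<comment> \<open>Invertibility comes from the lift itself, whose inverse this matrix
      is.\<close>
    have "det (?Q x) \<noteq> 0" using sym_spaceD(3)[OF Q(1)[OF x]] by simp
    then show "det (frame_dual_metric (?G x) (\<lambda>u. dir_deriv (rep c) u x) (rep c x)) \<noteq> 0"
      by (simp add: blaschke_frame.adapted_inverse[OF frame[OF c x] adapted[OF x], symmetric] det_matrix_inv)
  qed
  then show smooth: "smooth_on ?U ?Q"
    by (rule smooth_on_cong[OF U, rotated])
      (simp add: blaschke_frame.adapted_eq[OF frame[OF c] adapted, symmetric])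
  have "blaschke_chart ?U (h c) ?G (rep c) ?Q"
  proof unfold_locales
    fix x u v assume x: "x \<in> ?U"
    obtain w where w: "dir_deriv (\<lambda>y. dir_deriv (rep c) u y) v x = dir_deriv (rep c) w x + h c x v u *\<^sub>R rep c x"
      using structure_equation[OF c x] by blast
    \<comment> \<open>The tangential part is orthogonal to f, and Q(f, f) = 1 leaves the coefficient
      h(v, u).\<close>
    show "scalar_prod (?Q x) (dir_deriv (\<lambda>y. dir_deriv (rep c) u y) v x) (rep c x) = scalar_prod (?G x) v u"
      unfolding w using Q[OF x] blaschke_frame.adapted_unit[OF frame[OF c x] adapted[OF x]] h[OF x]
      by (simp add: scalar_prod_simps)
  qed (use Q h smooth rep(1)[OF c] frame_span[OF c]
      blaschke_frame.adapted_unit[OF frame[OF c] adapted] in auto)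
  then show "tension_field ?U (h c) sym_space killing_metric ?Q x = 0" if "x \<in> ?U" for x
    using that by (rule blaschke_chart.tension_field_eq_0)
qed

end

theorem theoremF:
  fixes A :: "('m::{t2_space, second_countable_topology}, 'n::finite) chart set"
    and h :: "('m, 'n) tensor2"
    and f :: "'m \<Rightarrow> real^('n option)"
  assumes "oriented_smooth_atlas A"
    and "hyperbolic_affine_sphere A h f"
  shows "harmonic_map A h sym_space killing_metric (blaschke_lift A h f)"
  by (rule affine_sphere.harmonic, unfold_locales) (rule assms)+

end
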